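(* Let $X$ and $Y$ be simplicial complexes, $f:X\to X$ and $g:Y\to Y$ open (continuous) maps, and $U\subset X$ and $V\subset Y$ open definable subspaces such that $f(U)\subset U$, $g(V)\subset V$, $f(X\setminus U)\subset X\setminus U$, $g(Y\setminus V)\subset Y\setminus V$, $f$ has no fixed points in $\overline{U}\setminus U$ and $g$ has no fixed points in $\overline{V}\setminus V$. If there is a homeomorphism $h:U\to V$ such that $g_{|V}\circ h=h\circ f_{|U}$, then $$i(X,f,U)=i(Y,g,V).$$
   Context: Fix an o-minimal structure on $\mathbb{R}$ containing all semilinear sets; "definable" refers to this structure. Simplicial complexes are finite (geometric, in some $\mathbb{R}^n$) and are identified with their underlying compact polyhedra. Closures $\overline{U}$, $\overline{V}$ are taken in $X$, $Y$ respectively. $i(X,f,U)$ denotes the classical fixed-point index of the self-map $f$ of the compact polyhedron $X$ on the open set $U\subset X$, defined when $f$ has no fixed points on the boundary of $U$. *)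

theory Defs
  imports "HOL-Analysis.Analysis" "HOL-Homology.Homology"
begin

section \<open>O-minimal structures on the real line\<close>

text \<open>Points of $R^n$ are lists of length \<open>n\<close>, so that the dimension can vary inside a formula.\<close>

definition Rn :: "nat \<Rightarrow> real list set" where
  "Rn n = {xs. length xs = n}"

text \<open>A structure in the sense of van den Dries is a sequence \<open>S\<close> of Boolean algebras \<open>S n\<close> of
  subsets of $R^n$ that is closed under cylinders and coordinate projections and contains the
  diagonals $x_1 = x_n$. It is o-minimal if it contains the order relation and the members of
  \<open>S 1\<close> are exactly the finite unions of points and (possibly unbounded) intervals.
  The predicate \<^const>\<open>is_interval\<close> allows endpoints and one-point intervals.\<close>

definition o_minimal_structure :: "(nat \<Rightarrow> real list set set) \<Rightarrow> bool" where
  "o_minimal_structure S \<longleftrightarrow>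
     (\<forall>n. Sigma_Algebra.algebra (Rn n) (S n)) \<and>
     (\<forall>n. \<forall>A \<in> S n. {x # xs | x xs. xs \<in> A} \<in> S (Suc n)) \<and>
     (\<forall>n. \<forall>A \<in> S n. {xs @ [x] | x xs. xs \<in> A} \<in> S (Suc n)) \<and>
     (\<forall>n\<ge>1. {xs \<in> Rn n. hd xs = last xs} \<in> S n) \<and>
     (\<forall>n. \<forall>A \<in> S (Suc n). butlast ` A \<in> S n) \<and>
     {[x, y] | x y. x < y} \<in> S 2 \<and>
     S 1 = {(\<lambda>x. [x]) ` (\<Union>\<I>) | \<I>. finite \<I> \<and> (\<forall>I \<in> \<I>. is_interval I)}"

text \<open>Semilinear sets: the Boolean combinations of the open affine half-spaces.\<close>

inductive_set semilinear_sets :: "nat \<Rightarrow> real list set set" for n :: nat where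
  half_space: "length a = n \<Longrightarrow> {x \<in> Rn n. (\<Sum>i<n. a ! i * x ! i) + c > 0} \<in> semilinear_sets n"
| complement: "A \<in> semilinear_sets n \<Longrightarrow> Rn n - A \<in> semilinear_sets n"
| union: "A \<in> semilinear_sets n \<Longrightarrow> B \<in> semilinear_sets n \<Longrightarrow> A \<union> B \<in> semilinear_sets n"

text \<open>A subset of a Euclidean space is definable if its set of coordinate vectors is. The order in
  which the basis is enumerated is irrelevant, as structures are closed under permutations of the
  coordinates.\<close>

definition definable_set ::
    "(nat \<Rightarrow> real list set set) \<Rightarrow> 'a::euclidean_space set \<Rightarrow> bool" where
  "definable_set S A \<longleftrightarrow>
     (\<exists>bs. distinct bs \<and> set bs = Basis \<and> (\<lambda>x. map (\<lambda>b. x \<bullet> b) bs) ` A \<in> S DIM('a))"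

section \<open>The fixed-point index\<close>

text \<open>We follow Dold. Let \<open>W\<close> be open in \<open>E\<close>, a Euclidean space of dimension \<open>n\<close>, and let
  \<open>\<phi>\<close> be a continuous map from \<open>W\<close> to \<open>E\<close> whose fixed-point set \<open>F\<close> is compact. Its index is the
  integer \<open>k\<close> such that
  $(id - \<phi>)_* : H_n(W, W - F) \to H_n(E, E - 0)$ maps the fundamental class $o_F$ to $k o_0$.
  Here $o_0$ and $o_F$ are induced by one and the same orientation of \<open>E\<close>, given below by a generator
  \<open>c\<close> of $H_n(E, E - B)$ for a closed ball \<open>B\<close> about 0 that contains \<open>F\<close>: the class $o_0$ is the
  image of \<open>c\<close> in $H_n(E, E - 0)$, and $o_F$, called \<open>w\<close> below, is the class in $H_n(W, W - F)$ that
  corresponds under excision to the image of \<open>c\<close> in $H_n(E, E - F)$. The integer \<open>k\<close> depends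
  neither on \<open>B\<close> nor on the orientation. Homology groups are written multiplicatively.\<close>

definition has_euclidean_index :: "'a::euclidean_space set \<Rightarrow> ('a \<Rightarrow> 'a) \<Rightarrow> int \<Rightarrow> bool" where
  "has_euclidean_index W \<phi> k \<longleftrightarrow>
     (let n = int DIM('a);
          E = (euclidean :: 'a topology);
          F = {x \<in> W. \<phi> x = x}
      in \<exists>R c w.
           R > 0 \<and> F \<subseteq> cball 0 R \<and>
           c \<in> carrier (relative_homology_group n E (- cball 0 R)) \<and>
           subgroup_generated (relative_homology_group n E (- cball 0 R)) {c}
             = relative_homology_group n E (- cball 0 R) \<and>
           w \<in> carrier (relative_homology_group n (top_of_set W) (W - F)) \<and>
           hom_induced n (top_of_set W) (W - F) E (- F) id w
             = hom_induced n E (- cball 0 R) E (- F) id c \<and>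
           hom_induced n (top_of_set W) (W - F) E (- {0}) (\<lambda>x. x - \<phi> x) w
             = hom_induced n E (- cball 0 R) E (- {0}) id c
                 [^]\<^bsub>relative_homology_group n E (- {0})\<^esub> k)"

text \<open>The index $i(X, f, U)$ of a self-map \<open>f\<close> of a compact polyhedron (more generally, of a compact
  Euclidean neighbourhood retract) \<open>X\<close> on an open subset \<open>U\<close> of \<open>X\<close>, meaningful when \<open>f\<close> has no fixed
  points on the boundary of \<open>U\<close>. For a retraction \<open>r\<close> of a neighbourhood \<open>N\<close> of \<open>X\<close> onto \<open>X\<close>,
  it is the index of \<open>f \<circ> r\<close> on the preimage of \<open>U\<close>, whose fixed points are those of \<open>f\<close> in \<open>U\<close>; it
  does not depend on the choice of \<open>r\<close>.\<close>

definition fixed_point_index :: "'a::euclidean_space set \<Rightarrow> ('a \<Rightarrow> 'a) \<Rightarrow> 'a set \<Rightarrow> int" where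
  "fixed_point_index X f U =
     (THE k. \<exists>N r. open N \<and> retraction N X r \<and> has_euclidean_index (N \<inter> r -` U) (f \<circ> r) k)"

end

(*
  Writing f' = f o r and g' = g o s for retractions r, s of neighbourhoods of X, Y, the maps
  h o r and f o h^-1 o s compose to f' in one order and to g' in the other, so the theorem is an
  instance of the commutativity of the index. Commutativity of the index of b o a and a o b is
  proved as by Dold: after stabilisation, the vector field (x - b (a x), y) on W x E' is deformed
  to (x - b y, y - a x), which is symmetric in the two maps. The deformations move the zeros within
  a compact set, which is why the index is computed relative to an arbitrary compact set containing
  them. Stabilisation adds one dimension at a time, through the isomorphisms
    H_(n+1) (X^, X^ - F) -> H_n (X^ - F, C) <- H_n (P, P - X^_F) -> H_n (X, X - F),
  where X^ = X x R, P = X x (0, oo), X^_F = F x R and C is X^ without F x [0, oo): the first is the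
  boundary map of the triple (X^, X^ - F, C), the second an excision, the third the projection.
*)
theory Submission
  imports Defs
begin

subsection \<open>Relative homology of pairs of subsets\<close>

text \<open>No orientation class is ever computed. Restriction, stabilisation and isometry each act
  on the orientation class, on the class \<open>w\<close> and on the target group at once, so a sign
  that such an isomorphism may carry occurs on both sides of the equation defining \<open>k\<close>.
  What has to be proved about them is naturality. This is also why exchanging the two factors of a
  product, which may reverse the orientation, leaves \<open>k\<close> alone. A type has a fixed
  dimension, whereas stabilisation climbs one dimension at a time. The intermediate spaces are
  therefore subsets X x span B of one product type, with B a set of basis vectors, and the new real
  coordinate is the direction of a unit vector orthogonal to the set that is suspended. The
  deformation from b (a x) to b y follows the segment from a x to y, which can leave the domain of
  b, as that open set need not be convex. The field is first restricted to a neighbourhood of the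
  graph of a over the fixed points, where the segments stay inside.\<close>

definition rel_hom :: "int \<Rightarrow> 'a::topological_space set \<Rightarrow> 'a set \<Rightarrow> 'a chain set monoid" where
  "rel_hom n X A = relative_homology_group n (top_of_set X) A"

definition ind :: "int \<Rightarrow> 'a::topological_space set \<Rightarrow> 'a set \<Rightarrow> 'b::topological_space set \<Rightarrow> 'b set
    \<Rightarrow> ('a \<Rightarrow> 'b) \<Rightarrow> 'a chain set \<Rightarrow> 'b chain set" where
  "ind n X A Y B f = hom_induced n (top_of_set X) A (top_of_set Y) B f"

text \<open>\<open>ind\<close> is a homomorphism for an arbitrary function, as
  \<open>ind_hom\<close> shows; the condition of being a map of pairs enters with functoriality
  (\<open>ind_compose\<close>) and with naturality of the boundary. Functions are total, so
  everything is required on \<open>X\<close> only.\<close>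

definition pair_map :: "'a::topological_space set \<Rightarrow> 'a set \<Rightarrow> 'b::topological_space set \<Rightarrow> 'b set
    \<Rightarrow> ('a \<Rightarrow> 'b) \<Rightarrow> bool" where
  "pair_map X A Y B f \<longleftrightarrow> A \<subseteq> X \<and> B \<subseteq> Y \<and> continuous_on X f \<and> f \<in> X \<rightarrow> Y \<and> f \<in> A \<rightarrow> B"

lemma pair_map_compose:
  "pair_map X A Y B f \<Longrightarrow> pair_map Y B Z C g \<Longrightarrow> pair_map X A Z C (g \<circ> f)"
  unfolding pair_map_def using continuous_on_compose2[of Y g X f] by (auto simp: o_def Pi_iff image_subset_iff)

lemma pair_map_id: "A \<subseteq> X \<Longrightarrow> B \<subseteq> Y \<Longrightarrow> X \<subseteq> Y \<Longrightarrow> A \<subseteq> B \<Longrightarrow> pair_map X A Y B id"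
  unfolding pair_map_def by auto

lemma group_rel_hom [simp]: "group (rel_hom n X A)"
  by (simp add: rel_hom_def)

lemma ind_hom: "ind n X A Y B f \<in> hom (rel_hom n X A) (rel_hom n Y B)"
  unfolding ind_def rel_hom_def by (rule hom_induced_hom)

lemma ind_carrier [simp]: "ind n X A Y B f c \<in> carrier (rel_hom n Y B)"
  unfolding ind_def rel_hom_def by (rule hom_induced_carrier)

lemma ind_compose:
  assumes "pair_map X A Y B f" "pair_map Y B Z C g"
  shows "ind n Y B Z C g (ind n X A Y B f c) = ind n X A Z C (g \<circ> f) c"
  using assms unfolding ind_def pair_map_def
  by (intro hom_induced_compose') auto

lemma ind_cong:
  assumes "\<And>x. x \<in> X \<Longrightarrow> f x = g x"
  shows "ind n X A Y B f = ind n X A Y B g"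
  unfolding ind_def by (rule hom_induced_eq) (use assms in auto)

lemma ind_id: "c \<in> carrier (rel_hom n X A) \<Longrightarrow> ind n X A X A id c = c"
  unfolding ind_def rel_hom_def by (rule hom_induced_id)

lemma ind_int_pow:
  assumes "c \<in> carrier (rel_hom n X A)"
  shows "ind n X A Y B f (c [^]\<^bsub>rel_hom n X A\<^esub> (k::int)) =
    ind n X A Y B f c [^]\<^bsub>rel_hom n Y B\<^esub> k"
  using assms by (intro hom_int_pow ind_hom) auto

lemma homotopic_pair_mapsI:
  fixes h :: "real \<times> 'a::topological_space \<Rightarrow> 'b::topological_space"
  assumes "continuous_on ({0..1} \<times> X) h" "h \<in> {0..1} \<times> X \<rightarrow> Y" "h \<in> {0..1} \<times> A \<rightarrow> B"
    and "A \<subseteq> X"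
    and f: "\<And>x. x \<in> X \<Longrightarrow> h (0, x) = f x" and g: "\<And>x. x \<in> X \<Longrightarrow> h (1, x) = g x"
  shows "homotopic_with (\<lambda>h. h \<in> A \<rightarrow> B) (top_of_set X) (top_of_set Y) f g"
proof (subst homotopic_with)
  show "(\<And>x. x \<in> topspace (top_of_set X) \<Longrightarrow> h x = k x) \<Longrightarrow> (h \<in> A \<rightarrow> B) = (k \<in> A \<rightarrow> B)" for h k
    using \<open>A \<subseteq> X\<close> by (force simp: Pi_iff)
  show "\<exists>h. continuous_map (prod_topology (top_of_set {0..1::real}) (top_of_set X)) (top_of_set Y) h \<and>
        (\<forall>x\<in>topspace (top_of_set X). h (0, x) = f x) \<and>
        (\<forall>x\<in>topspace (top_of_set X). h (1, x) = g x) \<and>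
        (\<forall>t\<in>{0..1}. (\<lambda>x. h (t, x)) \<in> A \<rightarrow> B)"
  proof (intro exI[of _ h] conjI)
    show "continuous_map (prod_topology (top_of_set {0..1}) (top_of_set X)) (top_of_set Y) h"
      using assms by (simp flip: subtopology_Times)
  qed (use assms in auto)
qed

lemma ind_homotopy:
  fixes h :: "real \<times> 'a::topological_space \<Rightarrow> 'b::topological_space"
  assumes "continuous_on ({0..1} \<times> X) h" "h \<in> {0..1} \<times> X \<rightarrow> Y" "h \<in> {0..1} \<times> A \<rightarrow> B"
    and "A \<subseteq> X"
    and "\<And>x. x \<in> X \<Longrightarrow> h (0, x) = f x" and "\<And>x. x \<in> X \<Longrightarrow> h (1, x) = g x"
  shows "ind n X A Y B f = ind n X A Y B g"
  unfolding ind_def by (intro homology_homotopy_axiom homotopic_pair_mapsI[OF assms])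

lemma ind_iso_homotopy_equivalence:
  assumes f: "pair_map X A Y B f" and g: "pair_map Y B X A g"
    and "homotopic_with (\<lambda>h. h \<in> A \<rightarrow> A) (top_of_set X) (top_of_set X) (g \<circ> f) id"
    and "homotopic_with (\<lambda>h. h \<in> B \<rightarrow> B) (top_of_set Y) (top_of_set Y) (f \<circ> g) id"
  shows "ind n X A Y B f \<in> iso (rel_hom n X A) (rel_hom n Y B)"
  unfolding ind_def rel_hom_def
  by (rule homotopy_equivalence_relative_homology_group_isomorphism[of _ _ f _ _ g])
    (use assms in \<open>auto simp: pair_map_def\<close>)

lemma ind_iso_homeomorphism:
  assumes f: "pair_map X A Y B f" and g: "pair_map Y B X A g"
    and gf: "\<And>x. x \<in> X \<Longrightarrow> g (f x) = x" and fg: "\<And>y. y \<in> Y \<Longrightarrow> f (g y) = y"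
  shows "ind n X A Y B f \<in> iso (rel_hom n X A) (rel_hom n Y B)"
proof (rule ind_iso_homotopy_equivalence[OF f g])
  have AB: "A \<subseteq> X" "B \<subseteq> Y" using f by (auto simp: pair_map_def)
  show "homotopic_with (\<lambda>h. h \<in> A \<rightarrow> A) (top_of_set X) (top_of_set X) (g \<circ> f) id"
    by (rule homotopic_pair_mapsI[where h = snd]) (use AB gf in \<open>auto intro!: continuous_intros\<close>)
  show "homotopic_with (\<lambda>h. h \<in> B \<rightarrow> B) (top_of_set Y) (top_of_set Y) (f \<circ> g) id"
    by (rule homotopic_pair_mapsI[where h = snd]) (use AB fg in \<open>auto intro!: continuous_intros\<close>)
qed

text \<open>The excised set is \<open>Y - X\<close>: it is relatively closed and contained in the
  relatively open \<open>B\<close>, so its closure lies in the interior of \<open>B\<close>.\<close>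

lemma ind_iso_excision:
  assumes "openin (top_of_set Y) B" "openin (top_of_set Y) X" "Y - B \<subseteq> X"
  shows "ind n X (X \<inter> B) Y B id \<in> iso (rel_hom n X (X \<inter> B)) (rel_hom n Y B)"
proof -
  have sub: "X \<subseteq> Y" "B \<subseteq> Y" using assms by (auto dest: openin_imp_subset)
  have "closedin (top_of_set Y) (Y - X)"
    using assms(2) by (simp add: openin_closedin_eq)
  then have "top_of_set Y closure_of (Y - X) \<subseteq> top_of_set Y interior_of B"
    using assms by (simp add: closure_of_closedin interior_of_openin) blast
  from homology_excision_axiom[OF this, of Y n] sub
  have "hom_induced n (subtopology (top_of_set Y) (Y - (Y - X))) (B - (Y - X))
      (subtopology (top_of_set Y) Y) B id \<in>
      iso (relative_homology_group n (subtopology (top_of_set Y) (Y - (Y - X))) (B - (Y - X)))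
          (relative_homology_group n (subtopology (top_of_set Y) Y) B)"
    by simp
  moreover have "Y - (Y - X) = X" "B - (Y - X) = X \<inter> B" "Y \<inter> X = X" using sub by auto
  ultimately show ?thesis
    by (simp add: ind_def rel_hom_def subtopology_subtopology)
qed

text \<open>The homotopy deforms the identity of the pair into a map that factors through
  \<open>(A, A)\<close>, whose relative homology vanishes.\<close>

lemma trivial_rel_hom:
  assumes "continuous_on ({0..1} \<times> X) h" "h \<in> {0..1} \<times> X \<rightarrow> X" "h \<in> {0..1} \<times> A \<rightarrow> A"
    and "A \<subseteq> X" and id: "\<And>x. x \<in> X \<Longrightarrow> h (0::real, x) = x"
    and into: "\<And>x. x \<in> X \<Longrightarrow> h (1, x) \<in> A"
  shows "trivial_group (rel_hom n X A)"
proof -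
  define g where "g = (\<lambda>x. h (1, x))"
  have cont: "continuous_on X g"
    unfolding g_def
    by (rule continuous_on_compose2[OF assms(1)]) (auto intro!: continuous_intros)
  have g: "pair_map X A A A g" and incl: "pair_map A A X A id"
    using assms cont by (auto simp: pair_map_def g_def)
  have "trivial_group (rel_hom n A A)"
    using trivial_relative_homology_group_topspace[of n "top_of_set A"] by (simp add: rel_hom_def)
  then have one: "carrier (rel_hom n A A) = {\<one>\<^bsub>rel_hom n A A\<^esub>}"
    by (simp add: trivial_group_def)
  have "c = \<one>\<^bsub>rel_hom n X A\<^esub>" if c: "c \<in> carrier (rel_hom n X A)" for c
  proof -
    have "c = ind n X A X A id c" using ind_id[OF c] by simp
    also have "ind n X A X A id = ind n X A X A (id \<circ> g)"
      by (rule ind_homotopy[where h = h]) (use assms in \<open>auto simp: g_def\<close>)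
    also have "ind n X A X A (id \<circ> g) c = ind n A A X A id (ind n X A A A g c)"
      by (rule ind_compose[OF g incl, symmetric])
    also have "ind n X A A A g c = \<one>\<^bsub>rel_hom n A A\<^esub>"
      using ind_carrier[of n X A A A g c] one by auto
    also have "ind n A A X A id \<one>\<^bsub>rel_hom n A A\<^esub> = \<one>\<^bsub>rel_hom n X A\<^esub>"
      by (intro hom_one ind_hom) auto
    finally show ?thesis .
  qed
  then show ?thesis
    unfolding trivial_group_def using group.is_monoid[OF group_rel_hom[of n X A]]
    by (auto intro: monoid.one_closed)
qed

section \<open>The exact sequence of a triple\<close>

definition bdry :: "int \<Rightarrow> 'a::topological_space set \<Rightarrow> 'a set \<Rightarrow> 'a set \<Rightarrow> 'a chain set \<Rightarrow> 'a chain set"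
  where "bdry n X B C = hom_relboundary n (top_of_set X) B C"

text \<open>In the exact sequence of the triple the boundary map stands between the groups of
  \<open>(X, C)\<close> in degrees \<open>n\<close> and \<open>n - 1\<close>, both trivial.\<close>

lemma iso_bdry:
  assumes "C \<subseteq> B" "B \<subseteq> X"
    and "trivial_group (rel_hom n X C)" "trivial_group (rel_hom (n - 1) X C)"
  shows "bdry n X B C \<in> iso (rel_hom n X B) (rel_hom (n - 1) B C)"
proof -
  have XB: "X \<inter> B = B" using assms by auto
  have "exact_seq ([rel_hom (n - 1) X C, rel_hom (n - 1) B C, rel_hom n X B, rel_hom n X C],
      [hom_induced (n - 1) (top_of_set B) C (top_of_set X) C id, bdry n X B C,
        hom_induced n (top_of_set X) C (top_of_set X) B id])"
    using homology_exactness_triple_1[OF \<open>C \<subseteq> B\<close>, of n "top_of_set X"]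
      homology_exactness_triple_2[OF \<open>C \<subseteq> B\<close>, of n "top_of_set X"]
    by (simp add: bdry_def rel_hom_def subtopology_subtopology XB)
  then show ?thesis
    by (rule very_short_exact_sequence) (use assms in auto)
qed

text \<open>Here the vanishing neighbours are the groups of \<open>(B, C)\<close> in degrees
  \<open>n\<close> and \<open>n - 1\<close>.\<close>

lemma ind_iso_triple:
  assumes "C \<subseteq> B" "B \<subseteq> X"
    and triv: "\<And>n. trivial_group (rel_hom n B C)"
  shows "ind n X C X B id \<in> iso (rel_hom n X C) (rel_hom n X B)"
proof -
  have XB: "X \<inter> B = B" using assms by auto
  have "exact_seq ([rel_hom (n - 1) B C, rel_hom n X B, rel_hom n X C, rel_hom n B C],
      [bdry n X B C, ind n X C X B id, ind n B C X C id])"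
    using homology_exactness_triple_1[OF \<open>C \<subseteq> B\<close>, of n "top_of_set X"]
      homology_exactness_triple_3[OF \<open>C \<subseteq> B\<close>, of n "top_of_set X"]
    by (simp add: bdry_def ind_def rel_hom_def subtopology_subtopology XB)
  then show ?thesis
    by (rule very_short_exact_sequence) (use triv in auto)
qed

lemma bdry_natural:
  assumes "pair_map X B Y B' f" "C \<subseteq> B" "C' \<subseteq> B'" "f \<in> C \<rightarrow> C'"
  shows "bdry n Y B' C' (ind n X B Y B' f c) = ind (n - 1) B C B' C' f (bdry n X B C c)"
proof -
  have "X \<inter> B = B" "Y \<inter> B' = B'" using assms by (auto simp: pair_map_def)
  then show ?thesis
    using fun_cong[OF naturality_hom_induced_relboundary[of "top_of_set X" "top_of_set Y" f B B' C C' n], of c]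
      assms
    by (simp add: bdry_def ind_def subtopology_subtopology pair_map_def)
qed

text \<open>Moves the clause that the orientation class generates its group along
  isomorphisms.\<close>

lemma subgroup_generated_singleton_iso:
  fixes G :: "'a monoid" and H :: "'b monoid"
  assumes f: "f \<in> iso G H" and "group G" "group H" "c \<in> carrier G"
  shows "subgroup_generated H {f c} = H \<longleftrightarrow> subgroup_generated G {c} = G"
proof -
  interpret group_hom G H f
    using assms by (simp add: group_hom_def group_hom_axioms_def iso_def)
  \<comment> \<open>\<open>subgroup_generated\<close> alters only the carrier field, so an equality
    of monoid records reduces to one of carriers.\<close>
  have eq: "subgroup_generated K S = K \<longleftrightarrow> carrier (subgroup_generated K S) = carrier K"
    if "group K" for K :: "'z monoid" and S
  proof
    assume "carrier (subgroup_generated K S) = carrier K"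
    then have "K\<lparr>carrier := carrier K\<rparr> = subgroup_generated K S"
      by (simp add: subgroup_generated_def)
    then show "subgroup_generated K S = K" by simp
  qed simp
  have "carrier (subgroup_generated H {f c}) = f ` carrier (subgroup_generated G {c})"
    using subgroup_generated_by_image[of "{c}"] assms by simp
  moreover have "carrier H = f ` carrier G" "inj_on f (carrier G)"
    using f by (auto simp: iso_def bij_betw_def)
  moreover have "carrier (subgroup_generated G {c}) \<subseteq> carrier G"
    by (rule G.carrier_subgroup_generated_subset)
  ultimately have "carrier (subgroup_generated H {f c}) = carrier H \<longleftrightarrow>
      carrier (subgroup_generated G {c}) = carrier G"
    by (metis inj_on_image_eq_iff order_refl)
  then show ?thesis
    using eq assms by metis
qed

subsection \<open>Suspension\<close>

text \<open>For a unit vector \<open>e\<close> this is the orthogonal projection along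
  \<open>e\<close>. When \<open>X\<close> is orthogonal to \<open>e\<close>, the sets
  \<open>hat e X\<close>, \<open>upper e X\<close> and \<open>lower e X F\<close> are the X^, P and
  C of the overview; the added coordinate is the height, that is, the inner product with
  \<open>e\<close>.\<close>

definition flat :: "'a::real_inner \<Rightarrow> 'a \<Rightarrow> 'a" where
  "flat e z = z - (z \<bullet> e) *\<^sub>R e"

definition hat :: "'a::real_inner \<Rightarrow> 'a set \<Rightarrow> 'a set" where
  "hat e X = {z. flat e z \<in> X}"

definition upper :: "'a::real_inner \<Rightarrow> 'a set \<Rightarrow> 'a set" where
  "upper e X = {z \<in> hat e X. z \<bullet> e > 0}"

definition lower :: "'a::real_inner \<Rightarrow> 'a set \<Rightarrow> 'a set \<Rightarrow> 'a set" where
  "lower e X F = {z \<in> hat e X. z \<bullet> e < 0 \<or> flat e z \<notin> F}"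

text \<open>The excision points against the direction of the composite, so it enters through its
  inverse on the carrier.\<close>

definition desuspend :: "'a::real_inner \<Rightarrow> int \<Rightarrow> 'a set \<Rightarrow> 'a set \<Rightarrow> 'a chain set \<Rightarrow> 'a chain set" where
  "desuspend e n X F =
     ind n (upper e X) (upper e (X - F)) X (X - F) (flat e) \<circ>
     inv_into (carrier (rel_hom n (upper e X) (upper e (X - F))))
       (ind n (upper e X) (upper e (X - F)) (hat e X - F) (lower e X F) id) \<circ>
     bdry (n + 1) (hat e X) (hat e X - F) (lower e X F)"

lemma continuous_on_flat [continuous_intros]:
  "continuous_on S f \<Longrightarrow> continuous_on S (\<lambda>x. flat e (f x))"
  unfolding flat_def by (intro continuous_intros)

lemma flat_orthogonal: "x \<bullet> e = 0 \<Longrightarrow> flat e x = x"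
  by (simp add: flat_def)

context
  fixes e :: "'a::real_inner"
  assumes norm_e: "norm e = 1"
begin

lemma inner_ee: "e \<bullet> e = 1"
  using norm_e by (simp add: norm_eq_1)

lemma flat_inner: "flat e z \<bullet> e = 0"
  by (simp add: flat_def inner_ee inner_diff_left)

lemma flat_add: "flat e (x + t *\<^sub>R e) = flat e x"
  by (simp add: flat_def inner_ee inner_add_left algebra_simps)

lemma flat_flat: "flat e (flat e x) = flat e x"
  by (simp add: flat_orthogonal flat_inner)

lemma inner_flat_add: "(flat e x + t *\<^sub>R e) \<bullet> e = t"
  by (simp add: inner_add_left flat_inner inner_ee)

lemma flat_flat_add: "flat e (flat e x + t *\<^sub>R e) = flat e x"
  by (simp add: flat_add flat_flat)

context
  fixes X F :: "'a set"
  assumes orth: "\<And>x. x \<in> X \<Longrightarrow> x \<bullet> e = 0" and F: "closedin (top_of_set X) F"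
begin

lemma F_sub: "F \<subseteq> X"
  using F closedin_imp_subset by blast

lemma trivial_rel_hom_lower: "trivial_group (rel_hom n (hat e X) (lower e X F))"
proof (rule trivial_rel_hom)
  \<comment> \<open>The height moves linearly to -1 while the projection stays fixed. Negative
    heights stay negative, and at time 1 every point is below 0, hence in
    \<open>lower\<close>.\<close>
  let ?h = "\<lambda>(t, z). flat e z + ((1 - t) * (z \<bullet> e) - t) *\<^sub>R e"
  show "continuous_on ({0..1} \<times> hat e X) ?h"
    unfolding case_prod_unfold by (intro continuous_intros)
  show "?h \<in> {0..1} \<times> hat e X \<rightarrow> hat e X"
    by (auto simp: hat_def flat_flat_add)
  have "(1 - t) * s - t < 0" if "0 \<le> t" "t \<le> 1" "s < 0" for t s :: real
    using that mult_nonneg_nonpos[of "1 - t" s] by (cases "t = 0") auto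
  then show "?h \<in> {0..1} \<times> lower e X F \<rightarrow> lower e X F"
    by (auto simp: hat_def lower_def flat_flat_add inner_flat_add)
  show "lower e X F \<subseteq> hat e X" by (auto simp: lower_def)
  show "?h (0, x) = x" if "x \<in> hat e X" for x by (simp add: flat_def)
  show "?h (1, x) \<in> lower e X F" if "x \<in> hat e X" for x
    using that flat_flat_add[of x "-1"] inner_flat_add[of x "-1"] by (simp add: hat_def lower_def)
qed

lemma iso_bdry_lower:
  "bdry (n + 1) (hat e X) (hat e X - F) (lower e X F)
     \<in> iso (rel_hom (n + 1) (hat e X) (hat e X - F)) (rel_hom n (hat e X - F) (lower e X F))"
proof -
  have "lower e X F \<subseteq> hat e X - F"
    using F_sub orth by (auto simp: lower_def flat_orthogonal)
  then show ?thesis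
    using iso_bdry[of "lower e X F" "hat e X - F" "hat e X" "n + 1"] trivial_rel_hom_lower by auto
qed

lemma upper_Int_lower: "upper e X \<inter> lower e X F = upper e (X - F)"
  by (auto simp: upper_def lower_def hat_def)

lemma iso_upper_lower:
  "ind n (upper e X) (upper e (X - F)) (hat e X - F) (lower e X F) id
     \<in> iso (rel_hom n (upper e X) (upper e (X - F))) (rel_hom n (hat e X - F) (lower e X F))"
proof -
  let ?B = "hat e X - F"
  have cont: "continuous_on ?B (flat e)" "continuous_on ?B (\<lambda>z. z \<bullet> e)"
    by (auto intro!: continuous_intros continuous_on_flat[of _ "\<lambda>x. x"])
  \<comment> \<open>\<open>lower\<close> is relatively open, being the union of the part below
    height 0 and the preimage of the relatively open \<open>X - F\<close> under the
    projection.\<close>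
  have neg: "openin (top_of_set ?B) (?B \<inter> (\<lambda>z. z \<bullet> e) -` {..<0})"
    by (rule continuous_openin_preimage_gen) (use cont in auto)
  have off: "openin (top_of_set ?B) (?B \<inter> flat e -` (X - F))"
    by (rule continuous_openin_preimage[of _ _ X])
      (use cont F in \<open>auto simp: hat_def openin_diff\<close>)
  have low: "lower e X F = (?B \<inter> (\<lambda>z. z \<bullet> e) -` {..<0}) \<union> (?B \<inter> flat e -` (X - F))"
    using F_sub orth by (auto simp: lower_def hat_def flat_orthogonal)
  have pos: "openin (top_of_set ?B) (?B \<inter> (\<lambda>z. z \<bullet> e) -` {0<..})"
    by (rule continuous_openin_preimage_gen) (use cont in auto)
  have up: "upper e X = ?B \<inter> (\<lambda>z. z \<bullet> e) -` {0<..}"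
    using F_sub orth by (fastforce simp: upper_def)
  \<comment> \<open>A point at height 0 that projects into \<open>F\<close> is itself in
    \<open>F\<close>, which \<open>?B\<close> excludes; so the height is strictly positive.\<close>
  have "?B - lower e X F \<subseteq> upper e X"
    using orth by (auto simp: lower_def upper_def hat_def not_less order_le_less flat_def)
  then show ?thesis
    using ind_iso_excision[of ?B "lower e X F" "upper e X" n] openin_Un[OF neg off] pos
    unfolding up[symmetric] low[symmetric] upper_Int_lower
    using \<open>?B - lower e X F \<subseteq> upper e X\<close> by blast
qed

text \<open>The pair upstairs is the product of \<open>(X, X - F)\<close> with an open half-line,
  which contracts to height 1; the homotopy inverse lifts by \<open>e\<close>.\<close>

lemma iso_upper_flat:
  "ind n (upper e X) (upper e (X - F)) X (X - F) (flat e)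
     \<in> iso (rel_hom n (upper e X) (upper e (X - F))) (rel_hom n X (X - F))"
proof (rule ind_iso_homotopy_equivalence)
  show "pair_map (upper e X) (upper e (X - F)) X (X - F) (flat e)"
    unfolding pair_map_def
    by (auto simp: upper_def hat_def intro!: continuous_on_flat[of _ "\<lambda>x. x"] continuous_intros)
  show "pair_map X (X - F) (upper e X) (upper e (X - F)) (\<lambda>x. x + e)"
    unfolding pair_map_def using orth flat_add[of _ 1]
    by (auto simp: upper_def hat_def flat_orthogonal inner_add_left inner_ee intro!: continuous_intros)
  show "homotopic_with (\<lambda>h. h \<in> upper e (X - F) \<rightarrow> upper e (X - F)) (top_of_set (upper e X))
     (top_of_set (upper e X)) ((\<lambda>x. x + e) \<circ> flat e) id"
  proof (rule homotopic_pair_mapsI)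
    let ?h = "\<lambda>(t, z). flat e z + ((1 - t) + t * (z \<bullet> e)) *\<^sub>R e"
    show "continuous_on ({0..1} \<times> upper e X) ?h"
      unfolding case_prod_unfold by (intro continuous_intros)
    have "(1 - t) + t * s > 0" if "0 \<le> t" "t \<le> 1" "s > 0" for t s :: real
      using that by (cases "t = 0") (auto intro: add_nonneg_pos)
    then show "?h \<in> {0..1} \<times> upper e X \<rightarrow> upper e X"
        "?h \<in> {0..1} \<times> upper e (X - F) \<rightarrow> upper e (X - F)"
      by (auto simp: hat_def upper_def flat_flat_add inner_flat_add)
    show "upper e (X - F) \<subseteq> upper e X" by (auto simp: upper_def hat_def)
  qed (auto simp: flat_def)
  show "homotopic_with (\<lambda>h. h \<in> X - F \<rightarrow> X - F) (top_of_set X) (top_of_set X) (flat e \<circ> (\<lambda>x. x + e)) id"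
    by (rule homotopic_pair_mapsI[where h = snd])
      (use orth flat_add[of _ 1] in \<open>auto simp: flat_orthogonal intro!: continuous_intros\<close>)
qed

lemma iso_desuspend:
  "desuspend e n X F \<in> iso (rel_hom (n + 1) (hat e X) (hat e X - F)) (rel_hom n X (X - F))"
  unfolding desuspend_def
  by (intro iso_set_trans[OF iso_bdry_lower
        iso_set_trans[OF group.iso_set_sym[OF group_rel_hom iso_upper_lower] iso_upper_flat],
        unfolded comp_assoc[symmetric]])

end

text \<open>The conditions on \<open>flat\<close> and on the height say that \<open>g\<close> is a
  product with the identity of the new coordinate, so it respects every set in the chain of
  isomorphisms. Each link is natural; the inverted excision is handled by injectivity.\<close>

lemma desuspend_natural:
  assumes X: "\<And>x. x \<in> X \<Longrightarrow> x \<bullet> e = 0" "closedin (top_of_set X) F"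
    and Y: "\<And>x. x \<in> Y \<Longrightarrow> x \<bullet> e = 0" "closedin (top_of_set Y) F'"
    and cont: "continuous_on (hat e X) g" and g: "g \<in> X \<rightarrow> Y" "g \<in> X - F \<rightarrow> Y - F'"
    and flat: "\<And>z. z \<in> hat e X \<Longrightarrow> flat e (g z) = g (flat e z)"
    and height: "\<And>z. z \<in> hat e X \<Longrightarrow> g z \<bullet> e = z \<bullet> e"
    and b: "b \<in> carrier (rel_hom (n + 1) (hat e X) (hat e X - F))"
  shows "desuspend e n Y F' (ind (n + 1) (hat e X) (hat e X - F) (hat e Y) (hat e Y - F') g b)
    = ind n X (X - F) Y (Y - F') g (desuspend e n X F b)"
proof -
  let ?PX = "upper e X" and ?PX' = "upper e (X - F)" and ?PY = "upper e Y" and ?PY' = "upper e (Y - F')"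
  let ?BX = "hat e X - F" and ?CX = "lower e X F" and ?BY = "hat e Y - F'" and ?CY = "lower e Y F'"
  have sub: "F \<subseteq> X" "F' \<subseteq> Y" using X Y F_sub by blast+
  have hatXY: "X \<subseteq> hat e X" "Y \<subseteq> hat e Y" using X Y by (auto simp: hat_def flat_orthogonal)
  have g_hat: "g z \<in> hat e Y" if "z \<in> hat e X" for z
    using that g flat by (auto simp: hat_def)
  have g_B: "g z \<in> ?BY" if "z \<in> ?BX" for z
  proof -
    \<comment> \<open>Heights are preserved and \<open>F'\<close> lies at height 0, so
      \<open>z\<close> would be a point of \<open>X - F\<close>, which \<open>g\<close> sends into
      \<open>Y - F'\<close>.\<close>
    have "g z \<notin> F'"
    proof
      assume "g z \<in> F'"
      then have "z \<bullet> e = 0" using sub Y(1) height that by (metis DiffD1 subsetD)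
      then have "z \<in> X - F" using that by (auto simp: hat_def flat_orthogonal)
      then show False using g \<open>g z \<in> F'\<close> by auto
    qed
    then show ?thesis using g_hat that by auto
  qed
  have C: "?CX \<subseteq> ?BX" "?CY \<subseteq> ?BY"
    using X Y sub by (auto simp: lower_def flat_orthogonal)
  have g_C: "g \<in> ?CX \<rightarrow> ?CY"
    using g g_hat flat height by (auto simp: lower_def hat_def)
  have g_P: "g \<in> ?PX \<rightarrow> ?PY" "g \<in> ?PX' \<rightarrow> ?PY'"
    using g g_hat flat height by (auto simp: upper_def hat_def)
  have P: "?PX \<subseteq> hat e X" "?PX' \<subseteq> ?PX" "?PY' \<subseteq> ?PY" "?PX \<subseteq> ?BX" "?PY \<subseteq> ?BY" "?PX' \<subseteq> ?CX" "?PY' \<subseteq> ?CY"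
    using X Y sub by (fastforce simp: upper_def lower_def hat_def)+
  have hat_map: "pair_map (hat e X) ?BX (hat e Y) ?BY g"
    using cont g_hat g_B by (auto simp: pair_map_def)
  have B_map: "pair_map ?BX ?CX ?BY ?CY g"
    using cont g_B g_C C by (auto simp: pair_map_def intro: continuous_on_subset)
  have P_map: "pair_map ?PX ?PX' ?PY ?PY' g"
    using cont g_P P by (auto simp: pair_map_def intro: continuous_on_subset)
  have X_map: "pair_map X (X - F) Y (Y - F') g"
    using cont g hatXY by (auto simp: pair_map_def intro: continuous_on_subset)
  have id_maps: "pair_map ?PX ?PX' ?BX ?CX id" "pair_map ?PY ?PY' ?BY ?CY id"
    using P C by (auto intro!: pair_map_id)
  have flat_maps: "pair_map ?PX ?PX' X (X - F) (flat e)" "pair_map ?PY ?PY' Y (Y - F') (flat e)"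
    unfolding pair_map_def
    by (auto simp: upper_def hat_def intro!: continuous_on_flat[of _ "\<lambda>x. x"] continuous_intros)
  define iX where "iX = ind n ?PX ?PX' ?BX ?CX id"
  define iY where "iY = ind n ?PY ?PY' ?BY ?CY id"
  define b' where "b' = bdry (n + 1) (hat e X) ?BX ?CX b"
  \<comment> \<open>\<open>u\<close> represents \<open>b'\<close> before the excision; the square
    for \<open>g\<close> is evaluated at \<open>u\<close>, and \<open>iY\<close> is cancelled
    afterwards.\<close>
  define u where "u = inv_into (carrier (rel_hom n ?PX ?PX')) iX b'"
  have isoX: "bij_betw iX (carrier (rel_hom n ?PX ?PX')) (carrier (rel_hom n ?BX ?CX))"
    using iso_upper_lower[OF X] by (simp add: iX_def iso_def)
  have isoY: "bij_betw iY (carrier (rel_hom n ?PY ?PY')) (carrier (rel_hom n ?BY ?CY))"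
    using iso_upper_lower[OF Y] by (simp add: iY_def iso_def)
  have b': "b' \<in> carrier (rel_hom n ?BX ?CX)"
    using iso_bdry_lower[OF X, of n] b by (auto simp: b'_def iso_def hom_def)
  have u: "u \<in> carrier (rel_hom n ?PX ?PX')" "iX u = b'"
    using isoX b' unfolding u_def by (auto simp: bij_betw_def f_inv_into_f inv_into_into)
  have "bdry (n + 1) (hat e Y) ?BY ?CY (ind (n + 1) (hat e X) ?BX (hat e Y) ?BY g b)
      = ind n ?BX ?CX ?BY ?CY g b'"
    using bdry_natural[OF hat_map C g_C, of "n + 1" b] by (simp add: b'_def)
  also have "\<dots> = iY (ind n ?PX ?PX' ?PY ?PY' g u)"
    unfolding u(2)[symmetric] iX_def iY_def
    by (simp add: ind_compose[OF id_maps(1) B_map] ind_compose[OF P_map id_maps(2)])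
  finally have "inv_into (carrier (rel_hom n ?PY ?PY')) iY
      (bdry (n + 1) (hat e Y) ?BY ?CY (ind (n + 1) (hat e X) ?BX (hat e Y) ?BY g b))
      = ind n ?PX ?PX' ?PY ?PY' g u"
    using isoY by (simp add: bij_betw_def inv_into_f_f)
  then have "desuspend e n Y F' (ind (n + 1) (hat e X) ?BX (hat e Y) ?BY g b)
      = ind n ?PY ?PY' Y (Y - F') (flat e) (ind n ?PX ?PX' ?PY ?PY' g u)"
    by (simp add: desuspend_def iY_def)
  also have "\<dots> = ind n ?PX ?PX' Y (Y - F') (flat e \<circ> g) u"
    by (rule ind_compose[OF P_map flat_maps(2)])
  also have "ind n ?PX ?PX' Y (Y - F') (flat e \<circ> g) = ind n ?PX ?PX' Y (Y - F') (g \<circ> flat e)"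
    by (rule ind_cong) (use flat P in auto)
  also have "\<dots> u = ind n X (X - F) Y (Y - F') g (ind n ?PX ?PX' X (X - F) (flat e) u)"
    by (rule ind_compose[OF flat_maps(1) X_map, symmetric])
  also have "ind n ?PX ?PX' X (X - F) (flat e) u = desuspend e n X F b"
    by (simp add: desuspend_def u_def b'_def iX_def)
  finally show ?thesis .
qed

end

subsection \<open>Stabilisation\<close>

abbreviation loc :: "int \<Rightarrow> 'a::topological_space set \<Rightarrow> 'a set \<Rightarrow> 'a chain set monoid" where
  "loc n X F \<equiv> rel_hom n X (X - F)"

abbreviation loc_ind :: "int \<Rightarrow> 'a::topological_space set \<Rightarrow> 'a set \<Rightarrow> 'b::topological_space set \<Rightarrow> 'b set
    \<Rightarrow> ('a \<Rightarrow> 'b) \<Rightarrow> 'a chain set \<Rightarrow> 'b chain set" where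
  "loc_ind n X F Y G f \<equiv> ind n X (X - F) Y (Y - G) f"

lemma orthogonal_span_Basis:
  fixes B :: "'b::euclidean_space set"
  assumes "insert b B \<subseteq> Basis" "b \<notin> B" "v \<in> span B"
  shows "v \<bullet> b = 0"
  using assms(3)
proof (induction rule: span_induct_alt)
  case (step c x y)
  moreover have "x \<bullet> b = 0" using step assms by (metis inner_Basis insert_subset subsetD)
  ultimately show ?case by (simp add: inner_add_left)
qed simp

lemma span_insert_flat:
  fixes B :: "'b::euclidean_space set"
  assumes "insert b B \<subseteq> Basis" "b \<notin> B"
  shows "v \<in> span (insert b B) \<longleftrightarrow> v - (v \<bullet> b) *\<^sub>R b \<in> span B"
proof
  assume "v \<in> span (insert b B)"
  then obtain k where k: "v - k *\<^sub>R b \<in> span B" by (auto simp: span_insert)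
  from orthogonal_span_Basis[OF assms k] have "k = v \<bullet> b" using assms by (simp add: inner_diff_left)
  then show "v - (v \<bullet> b) *\<^sub>R b \<in> span B" using k by simp
qed (auto simp: span_insert)

text \<open>A natural isomorphism that removes the factor \<open>S\<close>; in the applications
  \<open>m\<close> is the dimension of \<open>S\<close>. One family serves all pairs, because the
  degree equation relates classes of several pairs and they must all be identified in the same
  way.\<close>

definition stab_iso :: "int \<Rightarrow> int \<Rightarrow> 'b::euclidean_space set \<Rightarrow>
    ('a::euclidean_space set \<Rightarrow> 'a set \<Rightarrow> ('a \<times> 'b) chain set \<Rightarrow> 'a chain set) \<Rightarrow> bool" where
  "stab_iso n m S \<sigma> \<longleftrightarrow>
    (\<forall>X F. closedin (top_of_set X) F \<longrightarrow> \<sigma> X F \<in> iso (loc (n + m) (X \<times> S) (F \<times> {0})) (loc n X F)) \<and>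
    (\<forall>X F Y G g c. closedin (top_of_set X) F \<longrightarrow> closedin (top_of_set Y) G \<longrightarrow>
       pair_map X (X - F) Y (Y - G) g \<longrightarrow> c \<in> carrier (loc (n + m) (X \<times> S) (F \<times> {0})) \<longrightarrow>
       \<sigma> Y G (loc_ind (n + m) (X \<times> S) (F \<times> {0}) (Y \<times> S) (G \<times> {0}) (map_prod g id) c)
         = loc_ind n X F Y G g (\<sigma> X F c))"

lemma stab_isoI:
  assumes "\<And>X F. closedin (top_of_set X) F \<Longrightarrow>
      \<sigma> X F \<in> iso (loc (n + m) (X \<times> S) (F \<times> {0})) (loc n X F)"
    and "\<And>X F Y G g c. closedin (top_of_set X) F \<Longrightarrow> closedin (top_of_set Y) G \<Longrightarrow>
       pair_map X (X - F) Y (Y - G) g \<Longrightarrow> c \<in> carrier (loc (n + m) (X \<times> S) (F \<times> {0})) \<Longrightarrow>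
       \<sigma> Y G (loc_ind (n + m) (X \<times> S) (F \<times> {0}) (Y \<times> S) (G \<times> {0}) (map_prod g id) c)
         = loc_ind n X F Y G g (\<sigma> X F c)"
  shows "stab_iso n m S \<sigma>"
  unfolding stab_iso_def by (intro conjI allI impI; rule assms; assumption)

lemma stab_iso_iso:
  assumes "stab_iso n m S \<sigma>" "closedin (top_of_set X) F"
  shows "\<sigma> X F \<in> iso (loc (n + m) (X \<times> S) (F \<times> {0})) (loc n X F)"
  using assms unfolding stab_iso_def by blast

lemma stab_iso_natural:
  assumes "stab_iso n m S \<sigma>" "closedin (top_of_set X) F" "closedin (top_of_set Y) G"
    "pair_map X (X - F) Y (Y - G) g" "c \<in> carrier (loc (n + m) (X \<times> S) (F \<times> {0}))"
  shows "\<sigma> Y G (loc_ind (n + m) (X \<times> S) (F \<times> {0}) (Y \<times> S) (G \<times> {0}) (map_prod g id) c)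
         = loc_ind n X F Y G g (\<sigma> X F c)"
  using assms(1)[unfolded stab_iso_def, THEN conjunct2, rule_format, OF assms(2-5)] .

text \<open>Adjoining a basis vector \<open>b\<close> turns \<open>X \<times> span B\<close> into
  its cylinder in the direction \<open>(0, b)\<close>, so one \<open>desuspend\<close> undoes the
  step and lowers the degree by one.\<close>

lemma ex_stab_iso:
  fixes B :: "'b::euclidean_space set"
  assumes "finite B" "B \<subseteq> Basis"
  shows "\<exists>\<sigma> :: 'a::euclidean_space set \<Rightarrow> 'a set \<Rightarrow> ('a \<times> 'b) chain set \<Rightarrow> 'a chain set.
    stab_iso n (int (card B)) (span B) \<sigma>"
  using assms
proof (induction B)
  case empty
  have fst: "pair_map (X \<times> {0}) (X \<times> {0} - F \<times> {0}) X (X - F) (fst :: 'a \<times> 'b \<Rightarrow> 'a)" for X F :: "'a set"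
    by (auto simp: pair_map_def intro!: continuous_intros)
  have inj: "pair_map X (X - F) (X \<times> {0::'b}) (X \<times> {0} - F \<times> {0}) (\<lambda>x. (x, 0))" for X F :: "'a set"
    by (auto simp: pair_map_def intro!: continuous_intros)
  have prod: "pair_map (X \<times> {0::'b}) (X \<times> {0} - F \<times> {0}) (Y \<times> {0}) (Y \<times> {0} - G \<times> {0}) (map_prod g id)"
    if "pair_map X (X - F) Y (Y - G) g" for X F Y G and g :: "'a \<Rightarrow> 'a"
    using that unfolding pair_map_def map_prod_def case_prod_unfold
    by (auto intro!: continuous_intros continuous_on_compose2[of X g])
  \<comment> \<open>The span of the empty set is \<open>{0}\<close>, and \<open>fst\<close> is then
    a homeomorphism of pairs.\<close>
  let ?\<sigma> = "\<lambda>X F. loc_ind n (X \<times> {0::'b}) (F \<times> {0}) X F (fst :: 'a \<times> 'b \<Rightarrow> 'a)"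
  have \<sigma>_iso: "?\<sigma> X F \<in> iso (loc n (X \<times> {0}) (F \<times> {0})) (loc n X F)" for X F :: "'a set"
    by (rule ind_iso_homeomorphism[OF fst inj]) auto
  have \<sigma>_nat: "?\<sigma> Y G (loc_ind n (X \<times> {0}) (F \<times> {0}) (Y \<times> {0}) (G \<times> {0}) (map_prod g id) c) =
      loc_ind n X F Y G g (?\<sigma> X F c)"
    if "pair_map X (X - F) Y (Y - G) g" for X F Y G c and g :: "'a \<Rightarrow> 'a"
    by (simp add: ind_compose[OF prod[OF that] fst] ind_compose[OF fst that] fst_comp_map_prod)
  have "stab_iso n 0 {0} ?\<sigma>"
  proof (rule stab_isoI)
    show "?\<sigma> X F \<in> iso (loc (n + 0) (X \<times> {0}) (F \<times> {0})) (loc n X F)" for X F :: "'a set"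
      unfolding add_0_right by (rule \<sigma>_iso)
    fix X F Y G :: "'a set" and g c
    assume g: "pair_map X (X - F) Y (Y - G) g"
    show "?\<sigma> Y G (loc_ind (n + 0) (X \<times> {0}) (F \<times> {0}) (Y \<times> {0}) (G \<times> {0}) (map_prod g id) c) =
      loc_ind n X F Y G g (?\<sigma> X F c)"
      unfolding add_0_right by (rule \<sigma>_nat[OF g])
  qed
  then show ?case by auto
next
  case (insert b B)
  let ?n = "n + int (card B)"
  let ?e = "(0, b) :: 'a \<times> 'b"
  obtain \<sigma> :: "'a set \<Rightarrow> 'a set \<Rightarrow> ('a \<times> 'b) chain set \<Rightarrow> 'a chain set" where
    \<sigma>: "stab_iso n (int (card B)) (span B) \<sigma>"
    using insert.IH insert.prems by auto
  note iso = stab_iso_iso[OF \<sigma>] and nat = stab_iso_natural[OF \<sigma>]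
  have card: "n + int (card (insert b B)) = ?n + 1"
    using insert.hyps by simp
  have e: "norm ?e = 1" using insert.prems by (simp add: norm_Pair)
  have flat: "flat ?e (x, v) = (x, v - (v \<bullet> b) *\<^sub>R b)" for x v
    by (simp add: flat_def)
  have hat: "hat ?e (X \<times> span B) = X \<times> span (insert b B)" for X
  proof (rule Set.set_eqI)
    fix z
    show "z \<in> hat ?e (X \<times> span B) \<longleftrightarrow> z \<in> X \<times> span (insert b B)"
      using span_insert_flat[OF insert.prems insert.hyps(2), of "snd z"]
      by (cases z) (simp only: hat_def flat mem_Collect_eq mem_Times_iff fst_conv snd_conv)
  qed
  have orth: "z \<bullet> ?e = 0" if "z \<in> X \<times> span B" for z X
    using that orthogonal_span_Basis[OF insert.prems insert.hyps(2)] by auto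
  have clo: "closedin (top_of_set (X \<times> span B)) (F \<times> {0})" if "closedin (top_of_set X) F" for X F :: "'a set"
    using that by (intro closedin_Times) (auto simp: span_zero)
  define \<tau> where "\<tau> = (\<lambda>X F. \<sigma> X F \<circ> desuspend ?e ?n (X \<times> span B) (F \<times> {0}))"
  have des: "desuspend ?e ?n (X \<times> span B) (F \<times> {0}) \<in>
      iso (loc (?n + 1) (X \<times> span (insert b B)) (F \<times> {0})) (loc ?n (X \<times> span B) (F \<times> {0}))"
    if "closedin (top_of_set X) F" for X F
    using iso_desuspend[OF e orth clo[OF that], where n = ?n] by (simp add: hat)
  have \<tau>_iso: "\<tau> X F \<in> iso (loc (?n + 1) (X \<times> span (insert b B)) (F \<times> {0})) (loc n X F)"
    if "closedin (top_of_set X) F" for X F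
    unfolding \<tau>_def by (rule iso_set_trans[OF des[OF that] iso[OF that]])
  have \<tau>_nat: "\<tau> Y G (loc_ind (?n + 1) (X \<times> span (insert b B)) (F \<times> {0}) (Y \<times> span (insert b B)) (G \<times> {0})
            (map_prod g id) c) = loc_ind n X F Y G g (\<tau> X F c)"
    if X: "closedin (top_of_set X) F" and Y: "closedin (top_of_set Y) G"
      and g: "pair_map X (X - F) Y (Y - G) g"
      and c: "c \<in> carrier (loc (?n + 1) (X \<times> span (insert b B)) (F \<times> {0}))" for X F Y G g c
  proof -
    have "desuspend ?e ?n (Y \<times> span B) (G \<times> {0})
        (loc_ind (?n + 1) (X \<times> span (insert b B)) (F \<times> {0}) (Y \<times> span (insert b B)) (G \<times> {0}) (map_prod g id) c)
      = loc_ind ?n (X \<times> span B) (F \<times> {0}) (Y \<times> span B) (G \<times> {0}) (map_prod g id)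
          (desuspend ?e ?n (X \<times> span B) (F \<times> {0}) c)"
      unfolding hat[symmetric]
    \<comment> \<open>\<open>map_prod g id\<close> acts on the first factor alone, so it commutes
      with the projection along \<open>(0, b)\<close> and keeps the height.\<close>
    proof (rule desuspend_natural[OF e orth clo[OF X] orth clo[OF Y]])
      show "continuous_on (hat ?e (X \<times> span B)) (map_prod g id)"
        using g unfolding hat map_prod_def case_prod_unfold pair_map_def
        by (auto intro!: continuous_intros continuous_on_compose2[of X g])
    qed (use g c in \<open>auto simp: pair_map_def hat flat\<close>)
    moreover have "desuspend ?e ?n (X \<times> span B) (F \<times> {0}) c \<in> carrier (loc ?n (X \<times> span B) (F \<times> {0}))"
      using des[OF X] c by (auto simp: iso_def hom_def)
    ultimately show ?thesis
      using nat[OF X Y g] by (simp add: \<tau>_def)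
  qed
  have "stab_iso n (int (card (insert b B))) (span (insert b B)) \<tau>"
  proof (rule stab_isoI)
    show "\<tau> X F \<in> iso (loc (n + int (card (insert b B))) (X \<times> span (insert b B)) (F \<times> {0})) (loc n X F)"
      if "closedin (top_of_set X) F" for X F
      unfolding card by (rule \<tau>_iso[OF that])
    fix X F Y G :: "'a set" and g c
    assume "closedin (top_of_set X) F" "closedin (top_of_set Y) G" "pair_map X (X - F) Y (Y - G) g"
      and c: "c \<in> carrier (loc (n + int (card (insert b B))) (X \<times> span (insert b B)) (F \<times> {0}))"
    then show "\<tau> Y G (loc_ind (n + int (card (insert b B))) (X \<times> span (insert b B)) (F \<times> {0})
        (Y \<times> span (insert b B)) (G \<times> {0}) (map_prod g id) c) = loc_ind n X F Y G g (\<tau> X F c)"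
      unfolding card by (rule \<tau>_nat)
  qed
  then show ?case by blast
qed

text \<open>The complement of \<open>D\<close> can be pushed radially into the complement of the
  ball, so this pair of complements has trivial homology and the exact sequence of the triple
  applies.\<close>

lemma iso_restrict_star_shaped:
  fixes D :: "'a::euclidean_space set"
  assumes "0 \<in> D" "D \<subseteq> cball 0 R"
    and star: "\<And>x t. x \<in> D \<Longrightarrow> 0 \<le> t \<Longrightarrow> t \<le> 1 \<Longrightarrow> t *\<^sub>R x \<in> D"
  shows "loc_ind n UNIV (cball 0 R) UNIV D id \<in> iso (loc n UNIV (cball 0 R)) (loc n UNIV D)"
proof (rule ind_iso_triple)
  have R: "R \<ge> 0" using assms by auto
  have nz: "x \<noteq> 0" if "x \<notin> D" for x using that assms by auto
  \<comment> \<open>Moves \<open>x\<close> outwards along its ray until the norm has grown by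
    \<open>t * R\<close>; the origin is in \<open>D\<close>, so no division by zero occurs. A ray
    that has left the star-shaped \<open>D\<close> never returns, and at time 1 the norm exceeds
    \<open>R\<close>.\<close>
  let ?h = "\<lambda>(t, x::'a). (1 + t * R / norm x) *\<^sub>R x"
  have norm: "norm (?h (t, x)) = norm x + t * R" if "x \<noteq> 0" "t \<ge> 0" for t x
  proof -
    have "norm (?h (t, x)) = (1 + t * R / norm x) * norm x" using that R by simp
    also have "\<dots> = norm x + t * R" using that by (simp add: distrib_right)
    finally show ?thesis .
  qed
  show "trivial_group (rel_hom n (UNIV - D) (UNIV - cball 0 R))" for n
  proof (rule trivial_rel_hom)
    show "continuous_on ({0..1} \<times> (UNIV - D)) ?h"
      unfolding case_prod_unfold using nz by (auto intro!: continuous_intros)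
    have "?h (t, x) \<notin> D" if "x \<notin> D" "0 \<le> t" for t x
    proof
      define s where "s = 1 + t * R / norm x"
      assume "?h (t, x) \<in> D"
      then have "s *\<^sub>R x \<in> D" by (simp add: s_def)
      moreover have "s \<ge> 1" using that R by (simp add: s_def)
      ultimately show False using star[of "s *\<^sub>R x" "1 / s"] that by simp
    qed
    then show "?h \<in> {0..1} \<times> (UNIV - D) \<rightarrow> UNIV - D" by auto
    have far: "x \<noteq> 0" if "norm x > R" for x :: 'a using that R by auto
    have "norm (?h (t, x)) > R" if "norm x > R" "0 \<le> t" for t x
      using norm[OF far[OF that(1)] that(2)] that R by (smt (verit) mult_nonneg_nonneg)
    then show "?h \<in> {0..1} \<times> (UNIV - cball 0 R) \<rightarrow> UNIV - cball 0 R" 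
      by (auto simp: Pi_iff not_le simp del: norm_scaleR)
    show "?h (1, x) \<in> UNIV - cball 0 R" if "x \<in> UNIV - D" for x
      using norm[of x 1] nz[of x] that by (simp del: norm_scaleR)
  qed (use assms in auto)
qed (use assms in auto)

text \<open>The set \<open>D\<close> carries the orientation class. Stabilising a ball yields a flat disc rather than
  a ball, so \<open>D\<close> is not required to be a ball here.\<close>

definition has_degree :: "int \<Rightarrow> 'a::euclidean_space set \<Rightarrow> 'a set \<Rightarrow> 'a set \<Rightarrow> ('a \<Rightarrow> 'a) \<Rightarrow> int \<Rightarrow> bool"
  where
  "has_degree n D W K \<psi> k \<longleftrightarrow>
     (\<exists>c \<in> carrier (loc n UNIV D). \<exists>w \<in> carrier (loc n W K).
        subgroup_generated (loc n UNIV D) {c} = loc n UNIV D \<and>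
        loc_ind n W K UNIV K id w = loc_ind n UNIV D UNIV K id c \<and>
        loc_ind n W K UNIV {0} \<psi> w = loc_ind n UNIV D UNIV {0} id c [^]\<^bsub>loc n UNIV {0}\<^esub> k)"

text \<open>The equations see \<open>c\<close> only through its images at \<open>K\<close> and at 0,
  and both factor through \<open>D\<close>; so a class on \<open>D'\<close> may be traded for its
  restriction to \<open>D\<close>.\<close>

lemma has_degree_restrict:
  assumes iso: "loc_ind n UNIV D' UNIV D id \<in> iso (loc n UNIV D') (loc n UNIV D)"
    and sub: "D \<subseteq> D'" "K \<subseteq> D" "0 \<in> D"
  shows "has_degree n D' W K \<psi> k \<longleftrightarrow> has_degree n D W K \<psi> k"
proof -
  let ?r = "loc_ind n UNIV D' UNIV D id"
  have bij: "?r ` carrier (loc n UNIV D') = carrier (loc n UNIV D)"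
    using iso by (auto simp: iso_def bij_betw_def)
  have comp: "loc_ind n UNIV D UNIV F id (?r c) = loc_ind n UNIV D' UNIV F id c" if "F \<subseteq> D" for F c
    using ind_compose[of UNIV "UNIV - D'" UNIV "UNIV - D" id UNIV "UNIV - F" id n c] sub that
    by (auto simp: pair_map_id Diff_mono)
  show ?thesis
    unfolding has_degree_def bij[symmetric] bex_simps
    by (rule bex_cong[OF refl])
      (use sub in \<open>simp add: comp subgroup_generated_singleton_iso[OF iso]\<close>)
qed

text \<open>After stabilisation every map in \<open>has_degree\<close> has the form
  \<open>map_prod g id\<close>, so one natural family translates all clauses. Its members are
  injective homomorphisms and hence preserve and reflect the equations, including the one with the
  power \<open>k\<close>.\<close>

lemma has_degree_stabilize:
  fixes W :: "'a::euclidean_space set"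
  assumes "closed D" "closed K" "K \<subseteq> D" "0 \<in> D" "K \<subseteq> W"
    and \<psi>: "pair_map W (W - K) UNIV (UNIV - {0}) \<psi>"
  shows "has_degree (n + int DIM('b)) (D \<times> {0::'b::euclidean_space}) (W \<times> UNIV) (K \<times> {0}) (map_prod \<psi> id) k
    \<longleftrightarrow> has_degree n D W K \<psi> k"
proof -
  obtain \<sigma> :: "'a set \<Rightarrow> 'a set \<Rightarrow> ('a \<times> 'b) chain set \<Rightarrow> 'a chain set" where
    \<sigma>: "stab_iso n (int DIM('b)) UNIV \<sigma>"
    using ex_stab_iso[of "Basis :: 'b set" n, OF finite_Basis order_refl] by (auto simp: span_Basis)
  note iso = stab_iso_iso[OF \<sigma>] and nat = stab_iso_natural[OF \<sigma>]
  let ?N = "n + int DIM('b)"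
  have clo: "closedin (top_of_set W) K" "closedin (top_of_set UNIV) K" "closedin (top_of_set UNIV) D"
    "closedin (top_of_set UNIV) {0::'a}"
    using assms by (auto simp: closed_subset)
  have maps: "pair_map W (W - K) UNIV (UNIV - K) id" "pair_map UNIV (UNIV - D) UNIV (UNIV - K) id"
    "pair_map UNIV (UNIV - D) UNIV (UNIV - {0}) id"
    using assms by (auto intro!: pair_map_id)
  have im: "\<sigma> X F ` carrier (loc ?N (X \<times> UNIV) (F \<times> {0})) = carrier (loc n X F)"
    and inj: "inj_on (\<sigma> X F) (carrier (loc ?N (X \<times> UNIV) (F \<times> {0})))"
    if "closedin (top_of_set X) F" for X F
    using iso[OF that] by (auto simp: iso_def bij_betw_def)
  have zero: "{0::'a} \<times> {0::'b} = {0}" by (simp add: zero_prod_def)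
  note N1 = nat[OF clo(1,2) maps(1)] nat[OF clo(3,2) maps(2)] and
     N2 = nat[OF clo(1,4) \<psi>] nat[OF clo(3,4) maps(3)]
  have pow: "\<sigma> UNIV {0} (x [^]\<^bsub>loc ?N (UNIV \<times> UNIV) ({0} \<times> {0})\<^esub> k) = \<sigma> UNIV {0} x [^]\<^bsub>loc n UNIV {0}\<^esub> k"
    if "x \<in> carrier (loc ?N (UNIV \<times> UNIV) ({0} \<times> {0}))" for x
    using iso[OF clo(4)] that by (intro hom_int_pow) (auto simp: iso_def)
  have eq: "x = y \<longleftrightarrow> \<sigma> X F x = \<sigma> X F y" if "closedin (top_of_set X) F"
    "x \<in> carrier (loc ?N (X \<times> UNIV) (F \<times> {0}))" "y \<in> carrier (loc ?N (X \<times> UNIV) (F \<times> {0}))" for x y X F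
    using inj[OF that(1)] that by (auto dest: inj_onD)
  show ?thesis
    \<comment> \<open>Surjectivity lets the quantifiers over \<open>c\<close> and \<open>w\<close>
      range over the stabilised classes; \<open>UNIV\<close> and \<open>{0}\<close> are written as
      products to match \<open>stab_iso\<close>.\<close>
    unfolding has_degree_def im[OF clo(1), symmetric] im[OF clo(3), symmetric] bex_simps(7)
      UNIV_Times_UNIV[symmetric] zero[symmetric]
  proof (intro bex_cong refl)
    fix c :: "('a \<times> 'b) chain set" and w :: "('a \<times> 'b) chain set"
    assume c: "c \<in> carrier (loc ?N (UNIV \<times> UNIV) (D \<times> {0}))" and w: "w \<in> carrier (loc ?N (W \<times> UNIV) (K \<times> {0}))"
    let ?c = "\<sigma> UNIV D c" and ?w = "\<sigma> W K w"
    have "loc_ind ?N (W \<times> UNIV) (K \<times> {0}) (UNIV \<times> UNIV) (K \<times> {0}) id w =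
        loc_ind ?N (UNIV \<times> UNIV) (D \<times> {0}) (UNIV \<times> UNIV) (K \<times> {0}) id c \<longleftrightarrow>
      loc_ind n W K UNIV K id ?w = loc_ind n UNIV D UNIV K id ?c"
      using N1(1)[OF w] N1(2)[OF c] by (simp add: map_prod.id eq[OF clo(2)])
    moreover have "loc_ind ?N (W \<times> UNIV) (K \<times> {0}) (UNIV \<times> UNIV) ({0} \<times> {0}) (map_prod \<psi> id) w =
        loc_ind ?N (UNIV \<times> UNIV) (D \<times> {0}) (UNIV \<times> UNIV) ({0} \<times> {0}) id c
          [^]\<^bsub>loc ?N (UNIV \<times> UNIV) ({0} \<times> {0})\<^esub> k \<longleftrightarrow>
      loc_ind n W K UNIV {0} \<psi> ?w = loc_ind n UNIV D UNIV {0} id ?c [^]\<^bsub>loc n UNIV {0}\<^esub> k"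
      unfolding eq[OF clo(4) ind_carrier group.int_pow_closed[OF group_rel_hom ind_carrier]]
        pow[OF ind_carrier]
      using N2(1)[OF w] N2(2)[OF c] by (simp only: map_prod.id)
    ultimately show "(subgroup_generated (loc ?N (UNIV \<times> UNIV) (D \<times> {0})) {c} = loc ?N (UNIV \<times> UNIV) (D \<times> {0}) \<and>
        loc_ind ?N (W \<times> UNIV) (K \<times> {0}) (UNIV \<times> UNIV) (K \<times> {0}) id w =
        loc_ind ?N (UNIV \<times> UNIV) (D \<times> {0}) (UNIV \<times> UNIV) (K \<times> {0}) id c \<and>
        loc_ind ?N (W \<times> UNIV) (K \<times> {0}) (UNIV \<times> UNIV) ({0} \<times> {0}) (map_prod \<psi> id) w =
        loc_ind ?N (UNIV \<times> UNIV) (D \<times> {0}) (UNIV \<times> UNIV) ({0} \<times> {0}) id c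
          [^]\<^bsub>loc ?N (UNIV \<times> UNIV) ({0} \<times> {0})\<^esub> k) \<longleftrightarrow>
      (subgroup_generated (loc n UNIV D) {?c} = loc n UNIV D \<and>
        loc_ind n W K UNIV K id ?w = loc_ind n UNIV D UNIV K id ?c \<and>
        loc_ind n W K UNIV {0} \<psi> ?w = loc_ind n UNIV D UNIV {0} id ?c [^]\<^bsub>loc n UNIV {0}\<^esub> k)"
      using subgroup_generated_singleton_iso[OF iso[OF clo(3)] group_rel_hom group_rel_hom c] by simp
  qed
qed

subsection \<open>The index of a vector field\<close>

lemma has_degree_radius:
  assumes "0 < R" "R \<le> R'" "K \<subseteq> cball 0 R"
  shows "has_degree n (cball 0 R') W K \<psi> k \<longleftrightarrow> has_degree n (cball 0 R) W K \<psi> k"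
proof (rule has_degree_restrict)
  show "loc_ind n UNIV (cball 0 R') UNIV (cball 0 R) id
      \<in> iso (loc n UNIV (cball 0 R')) (loc n UNIV (cball (0::'a) R))"
  proof (rule iso_restrict_star_shaped)
    show "t *\<^sub>R x \<in> cball 0 R" if "x \<in> cball 0 R" "0 \<le> t" "t \<le> 1" for x :: 'a and t
      using that mult_left_le_one_le[of "norm x" t] by auto
  qed (use assms in auto)
qed (use assms in auto)

text \<open>Excision of the complement of \<open>W\<close>. It makes the class \<open>w\<close> in
  \<open>has_degree\<close> exist and be unique once \<open>c\<close> is chosen.\<close>

lemma iso_open_inclusion:
  assumes "open W" "closed K" "K \<subseteq> W"
  shows "loc_ind n W K UNIV K id \<in> iso (loc n W K) (loc n UNIV K)"
proof -
  have "W \<inter> (UNIV - K) = W - K" by auto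
  then show ?thesis
    using ind_iso_excision[of UNIV "UNIV - K" W n] assms by (simp add: Compl_eq_Diff_UNIV[symmetric] open_Compl)
qed

text \<open>Covers both a smaller domain and a larger compact set. The inclusion \<open>?j\<close>
  sends the class belonging to \<open>c\<close> on the inner pair to the one on the outer pair, and
  \<open>\<psi>\<close> has the same value on both.\<close>

lemma has_degree_nested:
  assumes W: "open W1" "open W2" "W1 \<subseteq> W2" and K: "closed K1" "closed K2" "K2 \<subseteq> K1" "K1 \<subseteq> W1"
    and \<psi>: "pair_map W2 (W2 - K2) UNIV (UNIV - {0}) \<psi>" and D: "K1 \<subseteq> D"
  shows "has_degree n D W1 K1 \<psi> k \<longleftrightarrow> has_degree n D W2 K2 \<psi> k"
proof -
  let ?j = "loc_ind n W1 K1 W2 K2 id"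
  let ?e1 = "loc_ind n W1 K1 UNIV K1 id" and ?e2 = "loc_ind n W2 K2 UNIV K2 id"
  let ?r1 = "loc_ind n UNIV D UNIV K1 id" and ?r2 = "loc_ind n UNIV D UNIV K2 id"
  have e1: "bij_betw ?e1 (carrier (loc n W1 K1)) (carrier (loc n UNIV K1))"
    using iso_open_inclusion[OF W(1) K(1,4), of n] by (simp add: iso_def)
  have e2: "bij_betw ?e2 (carrier (loc n W2 K2)) (carrier (loc n UNIV K2))"
    using iso_open_inclusion[OF W(2) K(2), of n] W K by (auto simp: iso_def)
  have maps: "pair_map W1 (W1 - K1) W2 (W2 - K2) id" "pair_map W2 (W2 - K2) UNIV (UNIV - K2) id"
    "pair_map W1 (W1 - K1) UNIV (UNIV - K1) id" "pair_map UNIV (UNIV - K1) UNIV (UNIV - K2) id"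
    "pair_map UNIV (UNIV - D) UNIV (UNIV - K1) id"
    using W K D by (auto intro!: pair_map_id)
  have ej: "?e2 (?j w) = loc_ind n UNIV K1 UNIV K2 id (?e1 w)" for w
    by (simp add: ind_compose[OF maps(1,2)] ind_compose[OF maps(3,4)])
  have rr: "loc_ind n UNIV K1 UNIV K2 id (?r1 c) = ?r2 c" for c
    by (simp add: ind_compose[OF maps(5,4)])
  have \<psi>j: "loc_ind n W2 K2 UNIV {0} \<psi> (?j w) = loc_ind n W1 K1 UNIV {0} \<psi> w" for w
    by (simp add: ind_compose[OF maps(1) \<psi>])
  \<comment> \<open>For fixed \<open>c\<close> each side has exactly one candidate \<open>w\<close>,
    so the existentials become statements about that class. \<open>P\<close> stands for the
    comparison with the \<open>k\<close>-th power.\<close>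
  have "(\<exists>w \<in> carrier (loc n W1 K1). ?e1 w = ?r1 c \<and> P (loc_ind n W1 K1 UNIV {0} \<psi> w)) \<longleftrightarrow>
      (\<exists>w \<in> carrier (loc n W2 K2). ?e2 w = ?r2 c \<and> P (loc_ind n W2 K2 UNIV {0} \<psi> w))" for c P
  proof -
    have "?r1 c \<in> ?e1 ` carrier (loc n W1 K1)"
      unfolding bij_betw_imp_surj_on[OF e1] by (rule ind_carrier)
    then obtain w1 where w1: "?e1 w1 = ?r1 c" "w1 \<in> carrier (loc n W1 K1)"
      by (elim imageE) (rule that, simp_all only:)
    have u1: "w = w1" if "w \<in> carrier (loc n W1 K1)" "?e1 w = ?r1 c" for w
      using inj_onD[OF bij_betw_imp_inj_on[OF e1], of w w1] w1 that by simp
    have j: "?e2 (?j w1) = ?r2 c" by (simp add: ej w1 rr)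
    then have u2: "w = ?j w1" if "w \<in> carrier (loc n W2 K2)" "?e2 w = ?r2 c" for w
      using inj_onD[OF bij_betw_imp_inj_on[OF e2], of w "?j w1"] that by simp
    have "(\<exists>w \<in> carrier (loc n W1 K1). ?e1 w = ?r1 c \<and> P (loc_ind n W1 K1 UNIV {0} \<psi> w)) \<longleftrightarrow>
        P (loc_ind n W1 K1 UNIV {0} \<psi> w1)"
      using w1 u1 by blast
    moreover have "(\<exists>w \<in> carrier (loc n W2 K2). ?e2 w = ?r2 c \<and> P (loc_ind n W2 K2 UNIV {0} \<psi> w)) \<longleftrightarrow>
        P (loc_ind n W2 K2 UNIV {0} \<psi> (?j w1))"
      using j u2 ind_carrier[of n W1 "W1 - K1" W2 "W2 - K2" id w1] by blast
    ultimately show ?thesis by (simp only: \<psi>j)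
  qed
  note * = this
  show ?thesis
    unfolding has_degree_def bex_simps(2) by (intro bex_cong refl conj_cong *)
qed

lemma has_degree_cong:
  assumes "\<And>x. x \<in> W \<Longrightarrow> \<psi> x = \<psi>' x"
  shows "has_degree n D W K \<psi> k \<longleftrightarrow> has_degree n D W K \<psi>' k"
  unfolding has_degree_def using ind_cong[of W \<psi> \<psi>', OF assms] by simp

lemma has_degree_homotopy:
  assumes "continuous_on ({0..1::real} \<times> W) h" "\<And>t x. t \<in> {0..1} \<Longrightarrow> x \<in> W - K \<Longrightarrow> h (t, x) \<noteq> 0"
    and "\<And>x. x \<in> W \<Longrightarrow> h (0, x) = \<psi> x" "\<And>x. x \<in> W \<Longrightarrow> h (1, x) = \<psi>' x"
  shows "has_degree n D W K \<psi> k \<longleftrightarrow> has_degree n D W K \<psi>' k"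
proof -
  have "loc_ind n W K UNIV {0} \<psi> = loc_ind n W K UNIV {0} \<psi>'"
    by (rule ind_homotopy[where h = h]) (use assms in auto)
  then show ?thesis by (simp add: has_degree_def)
qed

definition vf_index :: "'a::euclidean_space set \<Rightarrow> 'a set \<Rightarrow> ('a \<Rightarrow> 'a) \<Rightarrow> int \<Rightarrow> bool" where
  "vf_index W K \<psi> k \<longleftrightarrow> (\<exists>R>0. K \<subseteq> cball 0 R \<and> has_degree (int DIM('a)) (cball 0 R) W K \<psi> k)"

text \<open>The link to the given definition, where the compact set is exactly the fixed-point set;
  larger sets \<open>K\<close> serve the intermediate deformations.\<close>

lemma has_euclidean_index_eq:
  "has_euclidean_index W \<phi> k \<longleftrightarrow> vf_index W {x \<in> W. \<phi> x = x} (\<lambda>x. x - \<phi> x) k"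
  unfolding has_euclidean_index_def vf_index_def has_degree_def rel_hom_def ind_def Let_def
    subtopology_UNIV Compl_eq_Diff_UNIV
  by blast

lemma vf_index_radius:
  fixes W :: "'a::euclidean_space set"
  assumes "0 < R" "K \<subseteq> cball 0 R"
  shows "vf_index W K \<psi> k \<longleftrightarrow> has_degree (int DIM('a)) (cball 0 R) W K \<psi> k"
proof
  assume "vf_index W K \<psi> k"
  then obtain R' where R': "R' > 0" "K \<subseteq> cball 0 R'" "has_degree (int DIM('a)) (cball 0 R') W K \<psi> k"
    by (auto simp: vf_index_def)
  then show "has_degree (int DIM('a)) (cball 0 R) W K \<psi> k"
    using has_degree_radius[of R R' K] has_degree_radius[of R' R K] assms by (meson linear)
qed (use assms in \<open>auto simp: vf_index_def\<close>)

lemma compact_in_cball: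
  fixes K :: "'a::euclidean_space set"
  assumes "compact K"
  obtains R where "R > 0" "K \<subseteq> cball 0 R"
proof -
  obtain R where "R > 0" "\<And>x. x \<in> K \<Longrightarrow> norm x \<le> R"
    using compact_imp_bounded[OF assms] by (auto simp: bounded_pos)
  then show thesis by (intro that[of R]) auto
qed

lemma vf_index_nested:
  assumes "open W1" "open W2" "W1 \<subseteq> W2" "compact K1" "compact K2" "K2 \<subseteq> K1" "K1 \<subseteq> W1"
    and "continuous_on W2 \<psi>" "\<And>x. x \<in> W2 - K2 \<Longrightarrow> \<psi> x \<noteq> 0"
  shows "vf_index W1 K1 \<psi> k \<longleftrightarrow> vf_index W2 K2 \<psi> k"
proof -
  obtain R where R: "R > 0" "K1 \<subseteq> cball 0 R" using compact_in_cball[OF assms(4)] .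
  have "pair_map W2 (W2 - K2) UNIV (UNIV - {0}) \<psi>"
    using assms by (auto simp: pair_map_def)
  moreover have "K2 \<subseteq> cball 0 R" using R assms by blast
  ultimately show ?thesis
    unfolding vf_index_radius[OF R] vf_index_radius[OF R(1) \<open>K2 \<subseteq> cball 0 R\<close>]
    by (intro has_degree_nested assms compact_imp_closed R)
qed

lemma vf_index_homotopy:
  assumes "continuous_on ({0..1::real} \<times> W) h" "\<And>t x. t \<in> {0..1} \<Longrightarrow> x \<in> W - K \<Longrightarrow> h (t, x) \<noteq> 0"
    and "\<And>x. x \<in> W \<Longrightarrow> h (0, x) = \<psi> x" "\<And>x. x \<in> W \<Longrightarrow> h (1, x) = \<psi>' x"
  shows "vf_index W K \<psi> k \<longleftrightarrow> vf_index W K \<psi>' k"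
  unfolding vf_index_def using has_degree_homotopy[OF assms] by blast

lemma vf_index_cong:
  assumes "\<And>x. x \<in> W \<Longrightarrow> \<psi> x = \<psi>' x"
  shows "vf_index W K \<psi> k \<longleftrightarrow> vf_index W K \<psi>' k"
  unfolding vf_index_def using has_degree_cong[of W \<psi> \<psi>', OF assms] by blast

lemma vf_index_stabilize:
  fixes W :: "'a::euclidean_space set"
  assumes "compact K" "K \<subseteq> W" "continuous_on W \<psi>" "\<And>x. x \<in> W - K \<Longrightarrow> \<psi> x \<noteq> 0"
  shows "vf_index W K \<psi> k \<longleftrightarrow> vf_index (W \<times> (UNIV :: 'b::euclidean_space set)) (K \<times> {0}) (map_prod \<psi> id) k"
proof -
  obtain R where R: "R > 0" "K \<subseteq> cball 0 R" using compact_in_cball[OF assms(1)] .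
  let ?D = "cball (0::'a) R \<times> {0::'b}" and ?n = "int DIM('a)" and ?N = "int DIM('a \<times> 'b)"
  have N: "?N = ?n + int DIM('b)" by simp
  \<comment> \<open>The flat disc is star-shaped about 0, so it carries the orientation as well as
    the ball of the product does.\<close>
  have eq: "has_degree ?N (cball 0 R) (W \<times> (UNIV :: 'b set)) (K \<times> {0}) (map_prod \<psi> id) k \<longleftrightarrow>
      has_degree ?N ?D (W \<times> UNIV) (K \<times> {0}) (map_prod \<psi> id) k"
  proof (rule has_degree_restrict)
    have sub: "?D \<subseteq> cball 0 R" by (auto simp: norm_Pair)
    show "loc_ind ?N UNIV (cball 0 R) UNIV ?D id \<in> iso (loc ?N UNIV (cball 0 R)) (loc ?N UNIV ?D)"
    proof (rule iso_restrict_star_shaped[OF _ sub])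
      show "t *\<^sub>R x \<in> ?D" if "x \<in> ?D" "0 \<le> t" "t \<le> 1" for x t
        using that mult_left_le_one_le[of "norm (fst x)" t] by auto
    qed (use R in \<open>auto simp: zero_prod_def\<close>)
    show "?D \<subseteq> cball 0 R" by (rule sub)
  qed (use R in \<open>auto simp: zero_prod_def\<close>)
  have "pair_map W (W - K) UNIV (UNIV - {0}) \<psi>"
    using assms by (auto simp: pair_map_def)
  then have "has_degree ?n (cball 0 R) W K \<psi> k \<longleftrightarrow> has_degree ?N ?D (W \<times> UNIV) (K \<times> {0}) (map_prod \<psi> id) k"
    unfolding N using assms R
    by (intro has_degree_stabilize[symmetric]) (auto simp: compact_imp_closed)
  also have "\<dots> \<longleftrightarrow> has_degree ?N (cball 0 R) (W \<times> (UNIV :: 'b set)) (K \<times> {0}) (map_prod \<psi> id) k"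
    by (rule eq[symmetric])
  also have "\<dots> \<longleftrightarrow> vf_index (W \<times> (UNIV :: 'b set)) (K \<times> {0}) (map_prod \<psi> id) k"
    by (rule vf_index_radius[symmetric]) (use R in \<open>auto simp: norm_Pair\<close>)
  finally show ?thesis
    using vf_index_radius[OF R] by blast
qed

text \<open>The witnesses are the images of \<open>c\<close> and \<open>w\<close> under
  \<open>L\<close>. Conjugating the field applies \<open>L\<close> in the target too, so an
  orientation-reversing \<open>L\<close> changes both sides of the degree equation alike.
  Preservation of the norm makes the image of the ball a ball of the same radius.\<close>

lemma vf_index_isometry:
  fixes L :: "'a::euclidean_space \<Rightarrow> 'b::euclidean_space" and L' :: "'b \<Rightarrow> 'a"
  assumes "vf_index W K \<psi> k" and dim: "DIM('a) = DIM('b)" and "K \<subseteq> W"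
    and L: "continuous_on UNIV L" "continuous_on UNIV L'" "\<And>x. L' (L x) = x" "\<And>y. L (L' y) = y"
    and norm: "\<And>x. norm (L x) = norm x"
    and \<psi>: "continuous_on W \<psi>" "\<And>x. x \<in> W - K \<Longrightarrow> \<psi> x \<noteq> 0"
  shows "vf_index (L ` W) (L ` K) (L \<circ> \<psi> \<circ> L') k"
proof -
  let ?n = "int DIM('a)"
  have L0: "L 0 = 0" "L' 0 = 0" using norm[of 0] L(3)[of 0] by auto
  have Leq: "L x = L y \<longleftrightarrow> x = y" for x y using L(3) by metis
  have norm': "norm (L' y) = norm y" for y using norm[of "L' y"] L(4) by simp
  have im: "L ` (A - B) = L ` A - L ` B" for A B using Leq by auto
  have surj: "L ` UNIV = UNIV" using L(4) by (metis surjI)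
  have ball: "L ` cball 0 R = cball 0 R" for R
  proof
    show "cball 0 R \<subseteq> L ` cball 0 R"
      using norm' L(4) by (auto simp: image_iff intro!: bexI[of _ "L' _"])
  qed (use norm in auto)
  have map: "pair_map X (X - F) (L ` X) (L ` X - L ` F) L" for X F
    using L(1) by (auto simp: pair_map_def Leq intro: continuous_on_subset)
  have map': "pair_map (L ` X) (L ` X - L ` F) X (X - F) L'" for X F
    using L(2) by (auto simp: pair_map_def L(3) intro: continuous_on_subset)
  have iso: "loc_ind ?n X F (L ` X) (L ` F) L \<in> iso (loc ?n X F) (loc ?n (L ` X) (L ` F))" for X F
    by (rule ind_iso_homeomorphism[OF map map']) (use L in auto)
  obtain R c w where R: "R > 0" "K \<subseteq> cball 0 R" and c: "c \<in> carrier (loc ?n UNIV (cball 0 R))"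
    and gen: "subgroup_generated (loc ?n UNIV (cball 0 R)) {c} = loc ?n UNIV (cball 0 R)"
    and w: "w \<in> carrier (loc ?n W K)"
    and wc: "loc_ind ?n W K UNIV K id w = loc_ind ?n UNIV (cball 0 R) UNIV K id c"
    and k: "loc_ind ?n W K UNIV {0} \<psi> w = loc_ind ?n UNIV (cball 0 R) UNIV {0} id c [^]\<^bsub>loc ?n UNIV {0}\<^esub> k"
    using assms(1) by (auto simp: vf_index_def has_degree_def)
  note isoU = iso[of UNIV, unfolded surj] and mapU = map[of UNIV, unfolded surj]
  let ?c = "loc_ind ?n UNIV (cball 0 R) UNIV (cball 0 R) L c" and ?w = "loc_ind ?n W K (L ` W) (L ` K) L w"
  have idmaps: "pair_map W (W - K) UNIV (UNIV - K) id" "pair_map UNIV (UNIV - cball 0 R) UNIV (UNIV - K) id"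
     "pair_map (L ` W) (L ` W - L ` K) UNIV (UNIV - L ` K) id"
     "pair_map UNIV (UNIV - cball 0 R) UNIV (UNIV - L ` K) id"
     "pair_map UNIV (UNIV - cball (0::'a) R) UNIV (UNIV - {0}) id"
     "pair_map UNIV (UNIV - cball (0::'b) R) UNIV (UNIV - {0}) id"
    using R norm by (auto intro!: pair_map_id)
  have \<psi>map: "pair_map W (W - K) UNIV (UNIV - {0}) \<psi>"
    using \<psi> by (auto simp: pair_map_def)
  have mapB: "pair_map UNIV (UNIV - cball 0 R) UNIV (UNIV - cball 0 R) L"
    using mapU[of "cball 0 R"] by (simp only: ball)
  have map0: "pair_map UNIV (UNIV - {0}) UNIV (UNIV - {0}) L"
    using mapU[of "{0}"] by (simp add: L0)
  have \<psi>map': "pair_map (L ` W) (L ` W - L ` K) UNIV (UNIV - {0}) (L \<circ> \<psi> \<circ> L')"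
    using pair_map_compose[OF map' pair_map_compose[OF \<psi>map map0]] by (simp add: o_assoc)
  have 1: "subgroup_generated (loc ?n UNIV (cball 0 R)) {?c} = loc ?n UNIV (cball 0 R)"
    using subgroup_generated_singleton_iso[OF isoU group_rel_hom group_rel_hom c] gen by (simp only: ball)
  have 2: "loc_ind ?n (L ` W) (L ` K) UNIV (L ` K) id ?w = loc_ind ?n UNIV (cball 0 R) UNIV (L ` K) id ?c"
  proof -
    have "loc_ind ?n (L ` W) (L ` K) UNIV (L ` K) id ?w = loc_ind ?n UNIV K UNIV (L ` K) L (loc_ind ?n W K UNIV K id w)"
      by (simp add: ind_compose[OF map idmaps(3)] ind_compose[OF idmaps(1) mapU])
    also have "\<dots> = loc_ind ?n UNIV (cball 0 R) UNIV (L ` K) id ?c"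
      unfolding wc by (simp add: ind_compose[OF idmaps(2) mapU] ind_compose[OF mapB idmaps(4)])
    finally show ?thesis .
  qed
  have 3: "loc_ind ?n (L ` W) (L ` K) UNIV {0} (L \<circ> \<psi> \<circ> L') ?w
      = loc_ind ?n UNIV (cball 0 R) UNIV {0} id ?c [^]\<^bsub>loc ?n UNIV {0}\<^esub> k"
  proof -
    have "loc_ind ?n (L ` W) (L ` K) UNIV {0} (L \<circ> \<psi> \<circ> L') ?w
        = loc_ind ?n W K UNIV {0} (L \<circ> \<psi> \<circ> L' \<circ> L) w"
      by (rule ind_compose[OF map \<psi>map'])
    also have "\<dots> = loc_ind ?n UNIV {0} UNIV {0} L (loc_ind ?n W K UNIV {0} \<psi> w)"
      unfolding ind_compose[OF \<psi>map map0] by (rule fun_cong[OF ind_cong]) (simp add: L)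
    also have "\<dots> = loc_ind ?n UNIV {0} UNIV {0} L (loc_ind ?n UNIV (cball 0 R) UNIV {0} id c) [^]\<^bsub>loc ?n UNIV {0}\<^esub> k"
      unfolding k by (rule ind_int_pow) simp
    also have "loc_ind ?n UNIV {0} UNIV {0} L (loc_ind ?n UNIV (cball 0 R) UNIV {0} id c)
        = loc_ind ?n UNIV (cball 0 R) UNIV {0} id ?c"
      by (simp add: ind_compose[OF idmaps(5) map0] ind_compose[OF mapB idmaps(6)])
    finally show ?thesis .
  qed
  have "has_degree ?n (cball 0 R) (L ` W) (L ` K) (L \<circ> \<psi> \<circ> L') k"
    unfolding has_degree_def using 1 2 3 by (intro bexI[of _ ?c] bexI[of _ ?w]) auto
  then show ?thesis
    unfolding vf_index_def using R norm dim by (intro exI[of _ R]) auto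
qed

subsection \<open>Commutativity\<close>

text \<open>The stabilised field lives on \<open>W \<times> UNIV\<close>, whereas \<open>?p2\<close>
  makes sense only for \<open>y\<close> in \<open>W'\<close>; so the domain is cut down to a
  neighbourhood of the graph and widened again at the end. Each change of domain or of compact set
  is an instance of \<open>vf_index_nested\<close>.\<close>

lemma vf_index_graph:
  fixes W :: "'a::euclidean_space set" and W' :: "'b::euclidean_space set"
  assumes W: "open W" "open W'"
    and \<alpha>: "continuous_on W \<alpha>" "\<alpha> \<in> W \<rightarrow> W'" and \<beta>: "continuous_on W' \<beta>" "\<beta> \<in> W' \<rightarrow> W"
    and F: "compact {x \<in> W. \<beta> (\<alpha> x) = x}"
  shows "vf_index W {x \<in> W. \<beta> (\<alpha> x) = x} (\<lambda>x. x - \<beta> (\<alpha> x)) k \<longleftrightarrow>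
    vf_index (W \<times> W') ((\<lambda>x. (x, \<alpha> x)) ` {x \<in> W. \<beta> (\<alpha> x) = x}) (\<lambda>(x, y). (x - \<beta> y, y - \<alpha> x)) k"
proof -
  define F where "F = {x \<in> W. \<beta> (\<alpha> x) = x}"
  define G where "G = (\<lambda>x. (x, \<alpha> x)) ` F"
  \<comment> \<open>Swept out by the zeros of the field with second component
    \<open>y - t *\<^sub>R \<alpha> x\<close> as \<open>t\<close> runs from 0 to 1.\<close>
  define K where "K = (\<lambda>(t, x). (x, t *\<^sub>R \<alpha> x)) ` ({0..1::real} \<times> F)"
  \<comment> \<open>Pairs \<open>(x, y)\<close> for which \<open>\<alpha> x\<close> and
    \<open>y\<close> share a convex open subset of \<open>W'\<close>, so that the segment between
    them stays in the domain of \<open>\<beta>\<close>.\<close>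
  define S where "S = \<Union>{(W \<inter> \<alpha> -` B) \<times> B | B. open B \<and> convex B \<and> B \<subseteq> W'}"
  let ?WE = "W \<times> (UNIV :: 'b set)"
  let ?p0 = "\<lambda>(x, y). (x - \<beta> (\<alpha> x), y)" and ?p1 = "\<lambda>(x, y). (x - \<beta> (\<alpha> x), y - \<alpha> x)"
    and ?p2 = "\<lambda>(x, y). (x - \<beta> y, y - \<alpha> x)"
  have FW: "F \<subseteq> W" and cF: "compact F" using F by (auto simp: F_def)
  have \<alpha>F: "continuous_on F \<alpha>" using \<alpha>(1) FW by (rule continuous_on_subset)
  have cont_\<beta>\<alpha>: "continuous_on W (\<lambda>x. \<beta> (\<alpha> x))"
    using \<alpha> \<beta> by (auto intro: continuous_on_compose2[OF \<beta>(1) \<alpha>(1)])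
  note fst_cont = continuous_on_compose2[OF _ continuous_on_fst[OF continuous_on_id]]
  have \<alpha>_fst: "continuous_on S (\<lambda>z. \<alpha> (fst z))" "continuous_on S (\<lambda>z. \<beta> (\<alpha> (fst z)))"
    if "fst ` S \<subseteq> W" for S :: "('a \<times> 'b) set"
    using that by (auto intro: fst_cont[OF \<alpha>(1)] fst_cont[OF cont_\<beta>\<alpha>])
  have \<alpha>_hom: "continuous_on S (\<lambda>z. \<alpha> (fst (snd z)))" "continuous_on S (\<lambda>z. \<beta> (\<alpha> (fst (snd z))))"
    if "fst ` snd ` S \<subseteq> W" for S :: "(real \<times> 'a \<times> 'b) set"
    using that by (auto intro!: continuous_on_compose2[OF \<alpha>(1)] continuous_on_compose2[OF cont_\<beta>\<alpha>]
        continuous_intros)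
  have p0: "continuous_on ?WE ?p0" and p1: "continuous_on ?WE ?p1"
    unfolding case_prod_unfold by (auto intro!: continuous_intros \<alpha>_fst)
  have p2: "continuous_on (W \<times> W') ?p2"
    unfolding case_prod_unfold
    by (auto intro!: continuous_intros \<alpha>_fst continuous_on_compose2[OF \<beta>(1)])
  have cG: "compact G"
    unfolding G_def by (intro compact_continuous_image continuous_intros \<alpha>F cF)
  have cK: "compact K"
    unfolding K_def case_prod_unfold
    by (intro compact_continuous_image compact_Times cF compact_Icc continuous_intros
        continuous_on_compose2[OF \<alpha>F]) auto
  have oS: "open S"
    unfolding S_def using W \<alpha>
    by (auto intro!: open_Union open_Times continuous_open_preimage)
  have S_sub: "S \<subseteq> W \<times> W'" unfolding S_def by auto
  have seg: "(1 - t) *\<^sub>R \<alpha> x + t *\<^sub>R y \<in> W'" if "(x, y) \<in> S" "0 \<le> t" "t \<le> 1" for x y t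
  proof -
    obtain B where "convex B" "B \<subseteq> W'" "\<alpha> x \<in> B" "y \<in> B" using \<open>(x, y) \<in> S\<close> by (auto simp: S_def)
    then show ?thesis using that convexD[of B "\<alpha> x" y "1 - t" t] by auto
  qed
  have G_S: "G \<subseteq> S"
  proof
    fix z assume "z \<in> G"
    then obtain x where x: "z = (x, \<alpha> x)" "x \<in> F" by (auto simp: G_def)
    then have "\<alpha> x \<in> W'" using FW \<alpha> by auto
    then obtain e where "e > 0" "ball (\<alpha> x) e \<subseteq> W'" using W by (meson openE)
    then show "z \<in> S"
      using x FW unfolding S_def
      by (intro UnionI[of "(W \<inter> \<alpha> -` ball (\<alpha> x) e) \<times> ball (\<alpha> x) e"]) (auto intro!: exI[of _ "ball (\<alpha> x) e"])
  qed
  have "F \<times> {0} \<subseteq> K" by (force simp: K_def)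
  moreover have "G \<subseteq> K" unfolding K_def G_def by (auto intro!: image_eqI[of _ _ "(1, _)"])
  moreover have "K \<subseteq> ?WE" using FW by (auto simp: K_def)
  ultimately have K: "F \<times> {0} \<subseteq> K" "G \<subseteq> K" "K \<subseteq> ?WE" .
  have "vf_index W F (\<lambda>x. x - \<beta> (\<alpha> x)) k \<longleftrightarrow>
      vf_index ?WE (F \<times> {0}) (map_prod (\<lambda>x. x - \<beta> (\<alpha> x)) id) k"
    using cF cont_\<beta>\<alpha> by (intro vf_index_stabilize) (auto simp: F_def intro!: continuous_intros)
  also have "map_prod (\<lambda>x. x - \<beta> (\<alpha> x)) id = ?p0" by auto
  also have "vf_index ?WE (F \<times> {0}) ?p0 k \<longleftrightarrow> vf_index ?WE K ?p0 k"
    by (rule vf_index_nested[symmetric])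
      (use W cK cF K p0 in \<open>auto simp: open_Times compact_Times F_def zero_prod_def\<close>)
  also have "\<dots> \<longleftrightarrow> vf_index ?WE K ?p1 k"
  proof (rule vf_index_homotopy)
    let ?h = "\<lambda>(t, z). (fst z - \<beta> (\<alpha> (fst z)), snd z - t *\<^sub>R \<alpha> (fst z))"
    show "continuous_on ({0..1} \<times> ?WE) ?h"
      unfolding case_prod_unfold by (intro continuous_intros \<alpha>_hom) auto
    show "?h (t, z) \<noteq> 0" if "t \<in> {0..1}" "z \<in> ?WE - K" for t z
      using that by (force simp: K_def F_def zero_prod_def)
  qed auto
  also have "\<dots> \<longleftrightarrow> vf_index ?WE G ?p1 k"
    by (rule vf_index_nested)
      (use W cK cG K p1 in \<open>auto simp: open_Times G_def F_def zero_prod_def\<close>)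
  also have "\<dots> \<longleftrightarrow> vf_index S G ?p1 k"
    by (rule vf_index_nested[symmetric])
      (use W oS S_sub cG G_S p1 in \<open>auto simp: open_Times G_def F_def zero_prod_def\<close>)
  also have "\<dots> \<longleftrightarrow> vf_index S G ?p2 k"
  proof (rule vf_index_homotopy)
    \<comment> \<open>At a zero \<open>y = \<alpha> x\<close>, so the segment degenerates to a point
      and \<open>x\<close> is fixed by \<open>\<beta> \<circ> \<alpha>\<close>: the zeros stay in
      \<open>G\<close> for every \<open>t\<close>.\<close>
    let ?h = "\<lambda>(t, z). (fst z - \<beta> ((1 - t) *\<^sub>R \<alpha> (fst z) + t *\<^sub>R snd z), snd z - \<alpha> (fst z))"
    show "continuous_on ({0..1} \<times> S) ?h"
      unfolding case_prod_unfold using S_sub seg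
      by (intro continuous_intros \<alpha>_hom continuous_on_compose2[OF \<beta>(1)]) auto
    show "?h (t, z) \<noteq> 0" if "t \<in> {0..1}" "z \<in> S - G" for t z
      using that S_sub by (auto simp: G_def F_def zero_prod_def simp flip: scaleR_add_left)
  qed auto
  also have "\<dots> \<longleftrightarrow> vf_index (W \<times> W') G ?p2 k"
    by (rule vf_index_nested)
      (use W oS S_sub cG G_S p2 in \<open>auto simp: open_Times G_def F_def zero_prod_def\<close>)
  finally show ?thesis unfolding F_def G_def .
qed

lemma vf_index_commute:
  fixes W :: "'a::euclidean_space set" and W' :: "'b::euclidean_space set"
  assumes W: "open W" "open W'"
    and \<alpha>: "continuous_on W \<alpha>" "\<alpha> \<in> W \<rightarrow> W'" and \<beta>: "continuous_on W' \<beta>" "\<beta> \<in> W' \<rightarrow> W"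
    and F: "compact {x \<in> W. \<beta> (\<alpha> x) = x}"
    and idx: "vf_index W {x \<in> W. \<beta> (\<alpha> x) = x} (\<lambda>x. x - \<beta> (\<alpha> x)) k"
  shows "vf_index W' {y \<in> W'. \<alpha> (\<beta> y) = y} (\<lambda>y. y - \<alpha> (\<beta> y)) k"
proof -
  let ?F = "{x \<in> W. \<beta> (\<alpha> x) = x}" and ?F' = "{y \<in> W'. \<alpha> (\<beta> y) = y}"
  let ?p = "\<lambda>(x, y). (x - \<beta> y, y - \<alpha> x)"
  have "?F' = \<alpha> ` ?F" using \<alpha> \<beta> by (force simp: image_iff)
  moreover have "compact (\<alpha> ` ?F)"
    by (rule compact_continuous_image[OF continuous_on_subset[OF \<alpha>(1)] F]) auto
  ultimately have F': "compact ?F'" by simp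
  \<comment> \<open>The graph of \<open>\<alpha>\<close> over one fixed-point set is, after the
    swap, the graph of \<open>\<beta>\<close> over the other; hence \<open>vf_index_graph\<close>
    also applies with the roles exchanged.\<close>
  have swap: "prod.swap ` (\<lambda>x. (x, \<alpha> x)) ` ?F = (\<lambda>y. (y, \<beta> y)) ` ?F'"
    using \<alpha> \<beta> by (force simp: image_iff)
  have "vf_index (W \<times> W') ((\<lambda>x. (x, \<alpha> x)) ` ?F) ?p k"
    using vf_index_graph[OF W \<alpha> \<beta> F] idx by blast
  then have "vf_index (prod.swap ` (W \<times> W')) (prod.swap ` (\<lambda>x. (x, \<alpha> x)) ` ?F) (prod.swap \<circ> ?p \<circ> prod.swap) k"
  proof (rule vf_index_isometry)
    show "continuous_on (W \<times> W') ?p"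
      unfolding case_prod_unfold
      by (auto intro!: continuous_intros continuous_on_compose2[OF \<alpha>(1)] continuous_on_compose2[OF \<beta>(1)])
    show "?p z \<noteq> 0" if "z \<in> W \<times> W' - (\<lambda>x. (x, \<alpha> x)) ` ?F" for z
      using that by (auto simp: zero_prod_def)
    show "norm (prod.swap z) = norm z" for z :: "'a \<times> 'b"
      by (cases z) (simp add: norm_Pair)
    show "continuous_on UNIV (prod.swap :: 'a \<times> 'b \<Rightarrow> 'b \<times> 'a)"
         "continuous_on UNIV (prod.swap :: 'b \<times> 'a \<Rightarrow> 'a \<times> 'b)"
      by (rule continuous_on_swap)+
  qed (use \<alpha> in auto)
  also have "prod.swap \<circ> ?p \<circ> prod.swap = (\<lambda>(y, x). (y - \<alpha> x, x - \<beta> y))" by auto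
  finally show ?thesis
    unfolding swap product_swap using vf_index_graph[OF W(2,1) \<beta> \<alpha> F'] by blast
qed

section \<open>Conjugate maps on neighbourhood retracts\<close>

lemma has_euclidean_index_conjugate:
  fixes X U :: "'a::euclidean_space set" and Y V :: "'b::euclidean_space set"
  assumes N: "open N" "retraction N X r" and N': "open N'" "retraction N' Y s"
    and U: "openin (top_of_set X) U" and V: "openin (top_of_set Y) V"
    and f: "continuous_on X f" "f ` U \<subseteq> U"
    and h: "homeomorphism U V h h'" and conj: "\<And>x. x \<in> U \<Longrightarrow> g (h x) = h (f x)"
    and F: "compact {x \<in> U. f x = x}"
    and idx: "has_euclidean_index (N \<inter> r -` U) (f \<circ> r) k"
  shows "has_euclidean_index (N' \<inter> s -` V) (g \<circ> s) k"
proof -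
  let ?W = "N \<inter> r -` U" and ?W' = "N' \<inter> s -` V"
  \<comment> \<open>Invariance of \<open>U\<close> under \<open>f\<close> puts the values of
    \<open>?\<beta>\<close> in \<open>U\<close>, where \<open>r\<close> is the identity. So
    \<open>r\<close> drops out of \<open>?\<alpha> \<circ> ?\<beta>\<close>, and the conjugacy turns
    \<open>h \<circ> f \<circ> h'\<close> into \<open>g\<close>.\<close>
  let ?\<alpha> = "h \<circ> r" and ?\<beta> = "f \<circ> h' \<circ> s"
  have UX: "U \<subseteq> X" and VY: "V \<subseteq> Y" using U V by (auto dest: openin_imp_subset)
  have r: "X \<subseteq> N" "continuous_on N r" "r ` N \<subseteq> X" "\<And>x. x \<in> X \<Longrightarrow> r x = x"
    using N(2) by (auto simp: retraction_def)
  have s: "Y \<subseteq> N'" "continuous_on N' s" "s ` N' \<subseteq> Y" "\<And>y. y \<in> Y \<Longrightarrow> s y = y"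
    using N'(2) by (auto simp: retraction_def)
  have hU: "\<And>x. x \<in> U \<Longrightarrow> h x \<in> V" "\<And>y. y \<in> V \<Longrightarrow> h' y \<in> U" "\<And>x. x \<in> U \<Longrightarrow> h' (h x) = x"
    "\<And>y. y \<in> V \<Longrightarrow> h (h' y) = y" "continuous_on U h" "continuous_on V h'"
    using h by (auto simp: homeomorphism_def)
  have open_W: "open ?W"
    using continuous_openin_preimage[OF r(2) _ U] r(3) N(1) by (auto dest: openin_open_trans)
  have open_W': "open ?W'"
    using continuous_openin_preimage[OF s(2) _ V] s(3) N'(1) by (auto dest: openin_open_trans)
  have sh: "h x \<in> N'" "s (h x) = h x" "s (h x) \<in> V" if "x \<in> U" for x
    using that s(1,4) hU(1) VY by (auto simp: subset_iff)
  then have \<alpha>': "?\<alpha> \<in> ?W \<rightarrow> ?W'" using hU by auto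
  have \<alpha>: "continuous_on ?W ?\<alpha>"
    using r hU by (intro continuous_on_compose) (auto intro: continuous_on_subset)
  have "h' ` s ` ?W' \<subseteq> X" using hU UX by auto
  then have \<beta>: "continuous_on ?W' ?\<beta>"
    using s hU continuous_on_subset[OF f(1)]
    by (intro continuous_on_compose) (auto intro: continuous_on_subset)
  have fU: "f x \<in> N" "r (f x) = f x" "f x \<in> U" if "x \<in> U" for x
  proof -
    show "f x \<in> U" using f(2) that by auto
    then show "f x \<in> N" "r (f x) = f x" using r(1,4) UX by auto
  qed
  then have \<beta>': "?\<beta> \<in> ?W' \<rightarrow> ?W" using hU by auto
  have \<beta>\<alpha>: "?\<beta> (?\<alpha> x) = (f \<circ> r) x" if "x \<in> ?W" for x
    using that sh hU by auto
  have \<alpha>\<beta>: "?\<alpha> (?\<beta> y) = (g \<circ> s) y" if "y \<in> ?W'" for y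
  proof -
    have "s y \<in> V" using that by auto
    then show ?thesis using conj[of "h' (s y)"] hU(2,4) fU(2) by simp
  qed
  have rU: "x \<in> N" "r x = x" if "x \<in> U" for x
    using that r(1,4) UX by auto
  \<comment> \<open>A fixed point of \<open>f \<circ> r\<close> is a value of \<open>f\<close> on
    \<open>U\<close>, hence lies in \<open>U\<close> and is fixed by \<open>r\<close>.\<close>
  have "x \<in> U" if "r x \<in> U" "f (r x) = x" for x
    using fU(3)[OF that(1)] that(2) by simp
  then have "x \<in> ?W \<and> (f \<circ> r) x = x \<longleftrightarrow> x \<in> U \<and> f x = x" for x
    unfolding Int_iff vimage_eq comp_apply using rU by metis
  then have "{x \<in> ?W. (f \<circ> r) x = x} = {x \<in> U. f x = x}"
    by (rule Collect_cong)
  moreover have sets: "{x \<in> ?W. ?\<beta> (?\<alpha> x) = x} = {x \<in> ?W. (f \<circ> r) x = x}"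
      "{y \<in> ?W'. ?\<alpha> (?\<beta> y) = y} = {y \<in> ?W'. (g \<circ> s) y = y}"
    by (rule Collect_cong, rule conj_cong[OF refl], simp only: \<beta>\<alpha> \<alpha>\<beta>)+
  ultimately have F': "compact {x \<in> ?W. ?\<beta> (?\<alpha> x) = x}" using F by simp
  have "vf_index ?W {x \<in> ?W. ?\<beta> (?\<alpha> x) = x} (\<lambda>x. x - ?\<beta> (?\<alpha> x)) k"
    using idx unfolding has_euclidean_index_eq sets(1)
    by (subst vf_index_cong[where \<psi>' = "\<lambda>x. x - (f \<circ> r) x"]) (simp_all only: \<beta>\<alpha>)
  from vf_index_commute[OF open_W open_W' \<alpha> \<alpha>' \<beta> \<beta>' F' this]
  show ?thesis
    unfolding has_euclidean_index_eq sets(2)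
    by (subst vf_index_cong[where \<psi>' = "\<lambda>y. y - ?\<alpha> (?\<beta> y)"]) (simp_all only: \<alpha>\<beta>)
qed

text \<open>The index passes from any neighbourhood retraction onto \<open>X\<close> to any one onto
  \<open>Y\<close>; the ENR property supplies the latter.\<close>

lemma ex_has_euclidean_index_conjugate:
  fixes X U :: "'a::euclidean_space set" and Y V :: "'b::euclidean_space set"
  assumes Y: "ENR Y" and U: "openin (top_of_set X) U" and V: "openin (top_of_set Y) V"
    and f: "continuous_on X f" "f ` U \<subseteq> U"
    and h: "homeomorphism U V h h'" and conj: "\<And>x. x \<in> U \<Longrightarrow> g (h x) = h (f x)"
    and F: "compact {x \<in> U. f x = x}"
    and idx: "\<exists>N r. open N \<and> retraction N X r \<and> has_euclidean_index (N \<inter> r -` U) (f \<circ> r) k"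
  shows "\<exists>N s. open N \<and> retraction N Y s \<and> has_euclidean_index (N \<inter> s -` V) (g \<circ> s) k"
proof -
  obtain N' s where "open N'" "retraction N' Y s"
    using Y by (auto simp: ENR_def retract_of_def)
  then show ?thesis
    using idx has_euclidean_index_conjugate[OF _ _ _ _ U V f h conj F] by blast
qed

text \<open>As the boundary carries no fixed points, those in \<open>U\<close> are all those in the
  closure of \<open>U\<close>, which form a closed subset of the compact \<open>X\<close>.\<close>

lemma compact_fixed_points:
  fixes X :: "'a::real_normed_vector set"
  assumes X: "compact X" "continuous_on X f" and "U \<subseteq> X"
    and no_fix: "\<And>x. x \<in> (top_of_set X) closure_of U - U \<Longrightarrow> f x \<noteq> x"
  shows "compact {x \<in> U. f x = x}"
proof -
  have "closedin (top_of_set X) (X \<inter> (\<lambda>x. f x - x) -` {0})"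
    using X by (intro continuous_closedin_preimage continuous_intros) auto
  then have "closedin (top_of_set X) ((top_of_set X) closure_of U \<inter> (X \<inter> (\<lambda>x. f x - x) -` {0}))"
    by (rule closedin_Int[OF closedin_closure_of])
  moreover have "U \<subseteq> (top_of_set X) closure_of U"
    using \<open>U \<subseteq> X\<close> by (simp add: closure_of_subset)
  then have "(top_of_set X) closure_of U \<inter> (X \<inter> (\<lambda>x. f x - x) -` {0}) = {x \<in> U. f x = x}"
    using \<open>U \<subseteq> X\<close> no_fix by (auto, blast)
  ultimately show ?thesis
    using closedin_compact[OF X(1)] by simp
qed

text \<open>Simplices are compact and convex, and a finite union of closed convex sets is an
  ENR.\<close>

lemma simplicial_complex_polyhedron:
  fixes K :: "'a::euclidean_space set set"
  assumes "simplicial_complex K"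
  shows "compact (\<Union>K)" and "ENR (\<Union>K)"
proof -
  have K: "finite K" "\<And>S. S \<in> K \<Longrightarrow> \<exists>n. n simplex S"
    using assms by (auto simp: simplicial_complex_def)
  then show "compact (\<Union>K)"
    by (meson compact_Union compact_simplex)
  show "ENR (\<Union>K)"
    using K by (meson ENR_finite_Union_convex_closed compact_imp_closed compact_simplex convex_simplex)
qed

theorem theorem3p15:
  fixes S :: "nat \<Rightarrow> real list set set"
    and K :: "'a::euclidean_space set set" and L :: "'b::euclidean_space set set"
    and X U :: "'a set" and Y V :: "'b set"
    and f :: "'a \<Rightarrow> 'a" and g :: "'b \<Rightarrow> 'b" and h :: "'a \<Rightarrow> 'b"
  assumes "o_minimal_structure S"
    and "\<And>n. semilinear_sets n \<subseteq> S n"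
    and "simplicial_complex K" and "X = \<Union>K"
    and "simplicial_complex L" and "Y = \<Union>L"
    and "continuous_map (top_of_set X) (top_of_set X) f"
    and "open_map (top_of_set X) (top_of_set X) f"
    and "continuous_map (top_of_set Y) (top_of_set Y) g"
    and "open_map (top_of_set Y) (top_of_set Y) g"
    and "openin (top_of_set X) U" and "definable_set S U"
    and "openin (top_of_set Y) V" and "definable_set S V"
    and "f ` U \<subseteq> U" and "g ` V \<subseteq> V"
    and "f ` (X - U) \<subseteq> X - U" and "g ` (Y - V) \<subseteq> Y - V"
    and "\<And>x. x \<in> (top_of_set X) closure_of U - U \<Longrightarrow> f x \<noteq> x"
    and "\<And>y. y \<in> (top_of_set Y) closure_of V - V \<Longrightarrow> g y \<noteq> y"
    and "homeomorphic_map (top_of_set U) (top_of_set V) h"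
    and "\<And>x. x \<in> U \<Longrightarrow> g (h x) = h (f x)"
  shows "fixed_point_index X f U = fixed_point_index Y g V"
proof -
  have X: "compact X" "ENR X" and Y: "compact Y" "ENR Y"
    using assms(3-6) simplicial_complex_polyhedron by auto
  have f: "continuous_on X f" and g: "continuous_on Y g" 
    using assms(7,9) by auto
  have sub: "U \<subseteq> X" "V \<subseteq> Y"
    using assms(11,13) by (auto dest: openin_imp_subset)
  obtain h' where "homeomorphic_maps (top_of_set U) (top_of_set V) h h'"
    using assms(21) by (auto simp: homeomorphic_map_maps)
  then have h: "homeomorphism U V h h'"
    by (intro homeomorphismI) (auto simp: homeomorphic_maps_def)
  \<comment> \<open>The situation is symmetric: \<open>h'\<close> conjugates \<open>g\<close> to
    \<open>f\<close>, which yields the converse implication below.\<close>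
  have conj': "f (h' y) = h' (g y)" if "y \<in> V" for y
  proof -
    have "h' y \<in> U" "h (h' y) = y" using h that by (auto simp: homeomorphism_def)
    then have "g y = h (f (h' y))" "f (h' y) \<in> U" using assms(15) assms(22)[of "h' y"] by auto
    then show ?thesis using h by (auto simp: homeomorphism_def)
  qed
  have "compact {x \<in> U. f x = x}" "compact {y \<in> V. g y = y}"
    using compact_fixed_points[OF X(1) f sub(1) assms(19)] compact_fixed_points[OF Y(1) g sub(2) assms(20)]
    by auto
  then have "(\<exists>N r. open N \<and> retraction N X r \<and> has_euclidean_index (N \<inter> r -` U) (f \<circ> r) k) \<longleftrightarrow>
      (\<exists>N s. open N \<and> retraction N Y s \<and> has_euclidean_index (N \<inter> s -` V) (g \<circ> s) k)" for k
    using ex_has_euclidean_index_conjugate[OF Y(2) assms(11,13) f assms(15) h assms(22)]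
      ex_has_euclidean_index_conjugate[OF X(2) assms(13,11) g assms(16) homeomorphism_symD[OF h] conj']
    by blast
  \<comment> \<open>The defining predicates agree for every \<open>k\<close>, so both definite
    descriptions denote the same integer.\<close>
  then show ?thesis by (simp add: fixed_point_index_def)
qed

end
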